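(* Consider the following properties. (i) The sequence $\pi$ is generic for $\beta$. (ii) The sequence $\mu$ is generic for $\nu_M$. (iii) The sequence $\mu$ satisfies the Chowla property. Then (i) $\Longrightarrow$ (ii) $\Longleftrightarrow$ (iii).
   Context: $\mathbb{N}^*=\{1,2,3,\ldots\}$. $(a_k)_{k\ge1}$ is a sequence of pairwise relatively prime integers $a_k\ge2$, and $b_k=a_k^2$, $\mathscr{B}=\{b_k:k\ge1\}$ (so $\sum_k1/b_k<\infty$). For $n\in\mathbb{N}^*$: $\eta_n=0$ if some $b_k$ divides $n$ and $\eta_n=1$ otherwise; $\delta_n=|\{k\ge1:a_k\text{ divides }n\}|$; $\pi_n=(-1)^{\delta_n}$; $\mu_n=\eta_n\pi_n$. Write $\eta=(\eta_n)_{n\in\mathbb{N}^*}$, $\pi=(\pi_n)_{n\in\mathbb{N}^*}$, $\mu=(\mu_n)_{n\in\mathbb{N}^*}$. $X=\{0,1\}^{\mathbb{N}^*}$, $Y=\{-1,1\}^{\mathbb{N}^*}$, $Z=\{-1,0,1\}^{\mathbb{N}^*}$, each with the shift $S$, $(Sx)_n=x_{n+1}$. For $\Gamma\subset\{-1,0,1\}$, a point $x\in\Gamma^{\mathbb{N}^*}$ is generic for a probability measure $\nu$ on $\Gamma^{\mathbb{N}^*}$ if $\frac1N\sum_{0\le n<N}\mathbf{1}_C(S^nx)\to\nu(C)$ as $N\to\infty$ for every cylinder set $C$ (a set obtained by prescribing finitely many coordinates). $\beta$ is the Bernoulli measure on $Y$ under which the coordinates are independent and uniformly distributed on $\{-1,1\}$.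 Let $\Omega=\prod_{k\ge1}\mathbb{Z}/b_k\mathbb{Z}$ with normalized Haar measure $\mathbb{P}$, and $\varphi:\Omega\to X$, $\varphi(\omega)_n=0$ if there exists $k\ge1$ with $\omega_k+n\equiv0\bmod b_k$, and $\varphi(\omega)_n=1$ otherwise; $\nu_{\mathscr{B}}$ is the pushforward of $\mathbb{P}$ by $\varphi$. $\nu_M$ is the probability measure on $Z$ which is the pushforward of $\nu_{\mathscr{B}}\otimes\beta$ by the map $X\times Y\to Z$, $(x,y)\mapsto(x_ny_n)_{n\in\mathbb{N}^*}$. The sequence $\mu$ satisfies the Chowla property if for any $r\ge1$, any integers $0\le s_1<\cdots<s_r$ and any $i_1,\ldots,i_r\in\{1,2\}$ not all equal to $2$, $\frac1N\sum_{1\le n\le N}\mu_{n+s_1}^{i_1}\cdots\mu_{n+s_r}^{i_r}\to0$ as $N\to\infty$. *)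

theory Defs
  imports "HOL-Probability.Probability" "HOL-Algebra.Product_Groups" "HOL-Number_Theory.Cong"
begin

text \<open>
  Sequences are indexed by the positive integers \<open>{1..}\<close>; a point of the sequence space over \<open>\<Gamma>\<close>
  is an extensional function (value \<open>undefined\<close> at index 0), as usual for product measures.
\<close>

section \<open>One-sided shifts and generic points\<close>

definition seq_space :: "int set \<Rightarrow> (nat \<Rightarrow> int) set" where
  "seq_space \<Gamma> = (\<Pi>\<^sub>E n\<in>{1..}. \<Gamma>)"

definition seq_algebra :: "int set \<Rightarrow> (nat \<Rightarrow> int) measure" where
  "seq_algebra \<Gamma> = (\<Pi>\<^sub>M n\<in>{1..}. count_space \<Gamma>)"

definition shift :: "(nat \<Rightarrow> int) \<Rightarrow> (nat \<Rightarrow> int)" where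
  "shift x = (\<lambda>n\<in>{1..}. x (n + 1))"

definition cylinder :: "int set \<Rightarrow> nat set \<Rightarrow> (nat \<Rightarrow> int) \<Rightarrow> (nat \<Rightarrow> int) set" where
  "cylinder \<Gamma> J w = {x \<in> seq_space \<Gamma>. \<forall>j\<in>J. x j = w j}"

definition generic :: "int set \<Rightarrow> (nat \<Rightarrow> int) \<Rightarrow> (nat \<Rightarrow> int) measure \<Rightarrow> bool" where
  "generic \<Gamma> x \<nu> \<longleftrightarrow>
     x \<in> seq_space \<Gamma> \<and> prob_space \<nu> \<and> sets \<nu> = sets (seq_algebra \<Gamma>) \<and>
     (\<forall>J w. finite J \<longrightarrow> J \<subseteq> {1..} \<longrightarrow> w \<in> J \<rightarrow> \<Gamma> \<longrightarrow>
        (\<lambda>N. (\<Sum>n<N. indicator (cylinder \<Gamma> J w) ((shift ^^ n) x)) / real N)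
          \<longlonglongrightarrow> measure \<nu> (cylinder \<Gamma> J w))"

section \<open>Normalized Haar measure on a product of finite groups\<close>

text \<open>
  The groups \<open>G i\<close> carry the discrete topology. For a countable index set and finite groups the
  product \<open>\<sigma>\<close>-algebra used here is the Borel \<open>\<sigma>\<close>-algebra of the compact metrizable product, on
  which every finite measure is regular, so that invariance and total mass 1 characterize the
  normalized Haar measure.
\<close>

definition normalized_haar ::
    "'i set \<Rightarrow> ('i \<Rightarrow> ('g, 'c) monoid_scheme) \<Rightarrow> ('i \<Rightarrow> 'g) measure" where
  "normalized_haar I G = (THE P. prob_space P \<and>
     sets P = sets (\<Pi>\<^sub>M i\<in>I. count_space (carrier (G i))) \<and>
     (\<forall>g \<in> carrier (product_group I G). distr P P (\<lambda>\<omega>. g \<otimes>\<^bsub>product_group I G\<^esub> \<omega>) = P))"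

lemma sets_PiM_uniform:
  "sets (\<Pi>\<^sub>M i\<in>I. uniform_count_measure (A i)) = sets (\<Pi>\<^sub>M i\<in>I. count_space (A i))"
  by (intro sets_PiM_cong) (auto simp: sets_uniform_count_measure)

lemma translate_card:
  fixes G (structure)
  assumes "group G" "g \<in> carrier G" "F \<subseteq> carrier G"
  shows "card {x \<in> carrier G. g \<otimes> x \<in> F} = card F"
proof -
  interpret group G by fact
  have "bij_betw (\<lambda>x. g \<otimes> x) {x \<in> carrier G. g \<otimes> x \<in> F} F"
    by (rule bij_betwI[where g="\<lambda>y. inv g \<otimes> y"])
       (use assms in \<open>auto simp: m_assoc[symmetric] subset_eq\<close>)
  thus ?thesis by (rule bij_betw_same_card)
qed

lemma normalized_haar_eq_PiM:
  fixes G :: "'i \<Rightarrow> ('g, 'c) monoid_scheme"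
  assumes grp: "\<And>i. i \<in> I \<Longrightarrow> group (G i)"
    and fin: "\<And>i. i \<in> I \<Longrightarrow> finite (carrier (G i))"
  shows "normalized_haar I G = (\<Pi>\<^sub>M i\<in>I. uniform_count_measure (carrier (G i)))"
proof -
  let ?U = "\<lambda>i. uniform_count_measure (carrier (G i))"
  let ?Q = "\<Pi>\<^sub>M i\<in>I. ?U i"
  let ?t = "\<lambda>g \<omega>. g \<otimes>\<^bsub>product_group I G\<^esub> \<omega>"
  have ne: "carrier (G i) \<noteq> {}" if "i \<in> I" for i
    using grp[OF that] by (metis group.is_monoid monoid.one_closed empty_iff)
  have pU: "prob_space (?U i)" if "i \<in> I" for i
    using fin[OF that] ne[OF that] by (intro prob_space_uniform_count_measure) auto
  have Q: "prob_space ?Q" by (rule prob_space_PiM) (rule pU)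
  have spQ: "space ?Q = (\<Pi>\<^sub>E i\<in>I. carrier (G i))"
    by (simp add: space_PiM space_uniform_count_measure)
  have emb: "prod_emb I ?U J (\<Pi>\<^sub>E j\<in>J. F j) = {\<omega> \<in> (\<Pi>\<^sub>E i\<in>I. carrier (G i)). \<forall>j\<in>J. \<omega> j \<in> F j}"
    if "J \<subseteq> I" for J F
    using that by (auto simp: prod_emb_def space_uniform_count_measure PiE_iff extensional_def)
  have embQ: "{\<omega> \<in> (\<Pi>\<^sub>E i\<in>I. carrier (G i)). \<forall>j\<in>J. \<omega> j \<in> F j} \<in> sets ?Q"
    if "finite J" "J \<subseteq> I" "\<And>j. j \<in> J \<Longrightarrow> F j \<subseteq> carrier (G j)" for J F
    using sets_PiM_I[of J I F ?U] that by (auto simp: emb sets_uniform_count_measure)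
  have emU: "emeasure ?Q {\<omega> \<in> (\<Pi>\<^sub>E i\<in>I. carrier (G i)). \<forall>j\<in>J. \<omega> j \<in> F j}
        = (\<Prod>j\<in>J. ennreal (card (F j) / card (carrier (G j))))"
    if "finite J" "J \<subseteq> I" "\<And>j. j \<in> J \<Longrightarrow> F j \<subseteq> carrier (G j)" for J F
  proof -
    have "emeasure ?Q (prod_emb I ?U J (\<Pi>\<^sub>E j\<in>J. F j)) = (\<Prod>j\<in>J. emeasure (?U j) (F j))"
      using that by (intro emeasure_PiM_emb pU) (auto simp: sets_uniform_count_measure)
    also have "\<dots> = (\<Prod>j\<in>J. ennreal (card (F j) / card (carrier (G j))))"
      using that fin by (intro prod.cong refl emeasure_uniform_count_measure) auto
    finally show ?thesis using that by (simp add: emb)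
  qed
  have eqI: "M = ?Q" if "sets M = sets ?Q"
    and "\<And>J F. finite J \<Longrightarrow> J \<subseteq> I \<Longrightarrow> (\<And>j. j \<in> J \<Longrightarrow> F j \<subseteq> carrier (G j)) \<Longrightarrow>
       emeasure M {\<omega> \<in> (\<Pi>\<^sub>E i\<in>I. carrier (G i)). \<forall>j\<in>J. \<omega> j \<in> F j}
        = (\<Prod>j\<in>J. ennreal (card (F j) / card (carrier (G j))))" for M
  proof -
    define U' where "U' = (\<lambda>i. if i \<in> I then ?U i else return (count_space UNIV) undefined)"
    have U': "prob_space (U' i)" for i
      using pU by (auto simp: U'_def intro!: prob_space_return)
    have QU': "PiM I U' = ?Q" by (rule PiM_cong) (auto simp: U'_def)
    interpret product_prob_space U' I
      using U' by (simp add: product_prob_space_def product_prob_space_axioms_def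
          product_sigma_finite_def prob_space_imp_sigma_finite)
    have "M = PiM I U'"
    proof (rule PiM_eq)
      show "sets M = sets (PiM I U')" using that(1) QU' by simp
    next
      fix J F assume J: "finite J" "J \<subseteq> I" "\<And>j. j \<in> J \<Longrightarrow> F j \<in> sets (U' j)"
      have F: "F j \<subseteq> carrier (G j)" if "j \<in> J" for j
      proof -
        have "j \<in> I" using J(2) that by auto
        thus ?thesis using J(3)[OF that] by (simp add: U'_def sets_uniform_count_measure)
      qed
      have "prod_emb I U' J (\<Pi>\<^sub>E j\<in>J. F j) = prod_emb I ?U J (\<Pi>\<^sub>E j\<in>J. F j)"
        using J by (auto simp: prod_emb_def PiE_iff U'_def)
      moreover have "(\<Prod>j\<in>J. emeasure (U' j) (F j))
          = (\<Prod>j\<in>J. ennreal (card (F j) / card (carrier (G j))))"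
      proof (rule prod.cong[OF refl])
        fix j assume j: "j \<in> J"
        hence jI: "j \<in> I" using J(2) by auto
        have "emeasure (?U j) (F j) = ennreal (card (F j) / card (carrier (G j)))"
          by (rule emeasure_uniform_count_measure[OF fin[OF jI] F[OF j]])
        thus "emeasure (U' j) (F j) = ennreal (card (F j) / card (carrier (G j)))"
          using jI by (simp add: U'_def)
      qed
      ultimately show "emeasure M (prod_emb I U' J (\<Pi>\<^sub>E j\<in>J. F j)) = (\<Prod>j\<in>J. emeasure (U' j) (F j))"
        using that(2)[of J F] J F by (simp add: emb)
    qed
    thus ?thesis by (simp add: QU')
  qed
  have tcl: "?t g \<omega> \<in> (\<Pi>\<^sub>E i\<in>I. carrier (G i))"
    if "g \<in> (\<Pi>\<^sub>E i\<in>I. carrier (G i))" "\<omega> \<in> (\<Pi>\<^sub>E i\<in>I. carrier (G i))" for g \<omega>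
  proof -
    have "g i \<otimes>\<^bsub>G i\<^esub> \<omega> i \<in> carrier (G i)" if "i \<in> I" for i
      using grp[OF that] \<open>g \<in> _\<close> \<open>\<omega> \<in> _\<close> that by (meson PiE_mem group.is_monoid monoid.m_closed)
    thus ?thesis by auto
  qed
  have tmeas: "?t g \<in> measurable M M"
    if g: "g \<in> (\<Pi>\<^sub>E i\<in>I. carrier (G i))" and M: "sets M = sets ?Q" for g M
  proof -
    have "(\<lambda>\<omega>. \<lambda>i\<in>I. g i \<otimes>\<^bsub>G i\<^esub> \<omega> i) \<in> measurable ?Q ?Q"
    proof (rule measurable_restrict)
      fix i assume i: "i \<in> I"
      have "(\<lambda>x. g i \<otimes>\<^bsub>G i\<^esub> x) \<in> measurable (?U i) (?U i)"
        using g i grp[OF i]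
        by (auto simp: measurable_def sets_uniform_count_measure space_uniform_count_measure
            intro!: monoid.m_closed group.is_monoid)
      thus "(\<lambda>\<omega>. g i \<otimes>\<^bsub>G i\<^esub> \<omega> i) \<in> measurable ?Q (?U i)"
        using measurable_component_singleton[OF i, of ?U] by (rule measurable_compose_rev)
    qed
    thus ?thesis using M by (simp cong: measurable_cong_sets)
  qed
  have tvim: "?t g -` {\<omega> \<in> (\<Pi>\<^sub>E i\<in>I. carrier (G i)). \<forall>j\<in>J. \<omega> j \<in> F j} \<inter> (\<Pi>\<^sub>E i\<in>I. carrier (G i))
      = {\<omega> \<in> (\<Pi>\<^sub>E i\<in>I. carrier (G i)). \<forall>j\<in>J. \<omega> j \<in> {x \<in> carrier (G j). g j \<otimes>\<^bsub>G j\<^esub> x \<in> F j}}"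
    if "g \<in> (\<Pi>\<^sub>E i\<in>I. carrier (G i))" "J \<subseteq> I" for g J F
  proof (rule Set.set_eqI)
    fix \<omega>
    show "\<omega> \<in> ?t g -` {\<omega> \<in> (\<Pi>\<^sub>E i\<in>I. carrier (G i)). \<forall>j\<in>J. \<omega> j \<in> F j} \<inter> (\<Pi>\<^sub>E i\<in>I. carrier (G i))
      \<longleftrightarrow> \<omega> \<in> {\<omega> \<in> (\<Pi>\<^sub>E i\<in>I. carrier (G i)). \<forall>j\<in>J. \<omega> j \<in> {x \<in> carrier (G j). g j \<otimes>\<^bsub>G j\<^esub> x \<in> F j}}"
    proof (cases "\<omega> \<in> (\<Pi>\<^sub>E i\<in>I. carrier (G i))")
      case True
      have "?t g \<omega> j = g j \<otimes>\<^bsub>G j\<^esub> \<omega> j" "\<omega> j \<in> carrier (G j)" if "j \<in> J" for j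
        using that \<open>J \<subseteq> I\<close> True by auto
      thus ?thesis using tcl[OF that(1) True] True by simp
    qed blast
  qed
  have inv: "distr ?Q ?Q (?t g) = ?Q" if "g \<in> (\<Pi>\<^sub>E i\<in>I. carrier (G i))" for g
  proof (rule eqI)
    fix J F assume J: "finite J" "J \<subseteq> I" "\<And>j. j \<in> J \<Longrightarrow> F j \<subseteq> carrier (G j)"
    have "emeasure (distr ?Q ?Q (?t g)) {\<omega> \<in> (\<Pi>\<^sub>E i\<in>I. carrier (G i)). \<forall>j\<in>J. \<omega> j \<in> F j}
       = emeasure ?Q {\<omega> \<in> (\<Pi>\<^sub>E i\<in>I. carrier (G i)). \<forall>j\<in>J. \<omega> j \<in> {x \<in> carrier (G j). g j \<otimes>\<^bsub>G j\<^esub> x \<in> F j}}"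
      by (subst emeasure_distr[OF tmeas[OF that refl] embQ[OF J]], simp, subst spQ)
         (simp only: tvim[OF that J(2)])
    also have "\<dots> = (\<Prod>j\<in>J. ennreal (card {x \<in> carrier (G j). g j \<otimes>\<^bsub>G j\<^esub> x \<in> F j} / card (carrier (G j))))"
      by (rule emU[OF J(1,2)]) auto
    also have "\<dots> = (\<Prod>j\<in>J. ennreal (card (F j) / card (carrier (G j))))"
    proof (rule prod.cong[OF refl])
      fix j assume j: "j \<in> J"
      with J(2) that have "card {x \<in> carrier (G j). g j \<otimes>\<^bsub>G j\<^esub> x \<in> F j} = card (F j)"
        by (intro translate_card grp J(3)) auto
      thus "ennreal (card {x \<in> carrier (G j). g j \<otimes>\<^bsub>G j\<^esub> x \<in> F j} / card (carrier (G j)))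
         = ennreal (card (F j) / card (carrier (G j)))" by simp
    qed
    finally show "emeasure (distr ?Q ?Q (?t g)) {\<omega> \<in> (\<Pi>\<^sub>E i\<in>I. carrier (G i)). \<forall>j\<in>J. \<omega> j \<in> F j}
       = (\<Prod>j\<in>J. ennreal (card (F j) / card (carrier (G j))))" .
  qed simp
  have uniq: "P = ?Q" if P: "prob_space P" and sP: "sets P = sets ?Q"
    and iP: "\<And>g. g \<in> (\<Pi>\<^sub>E i\<in>I. carrier (G i)) \<Longrightarrow> distr P P (?t g) = P" for P
  proof (rule eqI[OF sP])
    fix J F assume J: "finite J" "J \<subseteq> I" "\<And>j. j \<in> J \<Longrightarrow> F j \<subseteq> carrier (G j)"
    interpret P: prob_space P by fact
    have spP: "space P = (\<Pi>\<^sub>E i\<in>I. carrier (G i))"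
      using sets_eq_imp_space_eq[OF sP] spQ by simp
    define C where "C = (\<lambda>w. {\<omega> \<in> (\<Pi>\<^sub>E i\<in>I. carrier (G i)). \<forall>j\<in>J. \<omega> j \<in> {w j}})"
    have C_sets: "C w \<in> sets P" if "w \<in> (\<Pi>\<^sub>E j\<in>J. carrier (G j))" for w
      unfolding C_def sP using J that by (intro embQ) auto
    define c where "c = P.prob (C (\<lambda>j\<in>J. \<one>\<^bsub>G j\<^esub>))"
    have one: "(\<lambda>j\<in>J. \<one>\<^bsub>G j\<^esub>) \<in> (\<Pi>\<^sub>E j\<in>J. carrier (G j))"
      using J(2) grp by (auto intro!: monoid.one_closed group.is_monoid)
    have C_eq: "P.prob (C w) = c" if w: "w \<in> (\<Pi>\<^sub>E j\<in>J. carrier (G j))" for w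
    proof -
      define g where "g = (\<lambda>i\<in>I. if i \<in> J then w i else \<one>\<^bsub>G i\<^esub>)"
      have g: "g \<in> (\<Pi>\<^sub>E i\<in>I. carrier (G i))"
        using w grp by (auto simp: g_def intro!: monoid.one_closed group.is_monoid)
      have "P.prob (C w) = measure (distr P P (?t g)) (C w)" by (simp only: iP[OF g])
      also have "\<dots> = P.prob (?t g -` C w \<inter> space P)"
        by (rule measure_distr[OF tmeas[OF g sP] C_sets[OF w]])
      also have "?t g -` C w \<inter> space P
         = {\<omega> \<in> (\<Pi>\<^sub>E i\<in>I. carrier (G i)). \<forall>j\<in>J. \<omega> j \<in> {x \<in> carrier (G j). g j \<otimes>\<^bsub>G j\<^esub> x \<in> {w j}}}"
        unfolding C_def spP by (rule tvim[OF g J(2)])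
      also have "\<dots> = C (\<lambda>j\<in>J. \<one>\<^bsub>G j\<^esub>)"
      proof -
        have "{x \<in> carrier (G j). g j \<otimes>\<^bsub>G j\<^esub> x \<in> {w j}} = {\<one>\<^bsub>G j\<^esub>}" if j: "j \<in> J" for j
        proof -
          interpret group "G j" using grp j J(2) by auto
          have wj: "w j \<in> carrier (G j)" using w j by auto
          have "g j = w j" using j J(2) by (auto simp: g_def)
          thus ?thesis using wj by auto
        qed
        thus ?thesis unfolding C_def by auto
      qed
      finally show ?thesis by (simp add: c_def)
    qed
    have sum_C: "P.prob {\<omega> \<in> (\<Pi>\<^sub>E i\<in>I. carrier (G i)). \<forall>j\<in>J. \<omega> j \<in> E j}
       = (\<Prod>j\<in>J. real (card (E j))) * c" if E: "\<And>j. j \<in> J \<Longrightarrow> E j \<subseteq> carrier (G j)" for E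
    proof -
      have sub: "(\<Pi>\<^sub>E j\<in>J. E j) \<subseteq> (\<Pi>\<^sub>E j\<in>J. carrier (G j))" using E by (rule PiE_mono)
      have finE: "finite (\<Pi>\<^sub>E j\<in>J. E j)"
      proof (intro finite_PiE[OF J(1)])
        show "finite (E j)" if "j \<in> J" for j
          using E[OF that] by (rule finite_subset) (use fin that J(2) in auto)
      qed
      have "{\<omega> \<in> (\<Pi>\<^sub>E i\<in>I. carrier (G i)). \<forall>j\<in>J. \<omega> j \<in> E j} = (\<Union>w\<in>(\<Pi>\<^sub>E j\<in>J. E j). C w)"
      proof (intro equalityI subsetI)
        fix \<omega> assume "\<omega> \<in> {\<omega> \<in> (\<Pi>\<^sub>E i\<in>I. carrier (G i)). \<forall>j\<in>J. \<omega> j \<in> E j}"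
        thus "\<omega> \<in> (\<Union>w\<in>(\<Pi>\<^sub>E j\<in>J. E j). C w)"
          by (intro UN_I[of "restrict \<omega> J"]) (auto simp: C_def)
      qed (auto simp: C_def)
      moreover have "disjoint_family_on C (\<Pi>\<^sub>E j\<in>J. E j)"
        unfolding disjoint_family_on_def
      proof (intro ballI impI)
        fix v w assume vw: "v \<in> (\<Pi>\<^sub>E j\<in>J. E j)" "w \<in> (\<Pi>\<^sub>E j\<in>J. E j)" "v \<noteq> w"
        then obtain j where "j \<in> J" "v j \<noteq> w j" using PiE_ext by metis
        thus "C v \<inter> C w = {}" by (auto simp: C_def)
      qed
      ultimately have "P.prob {\<omega> \<in> (\<Pi>\<^sub>E i\<in>I. carrier (G i)). \<forall>j\<in>J. \<omega> j \<in> E j}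
          = (\<Sum>w\<in>(\<Pi>\<^sub>E j\<in>J. E j). P.prob (C w))"
        using finE C_sets sub by (simp only:) (intro P.finite_measure_finite_Union, auto)
      also have "\<dots> = (\<Sum>w\<in>(\<Pi>\<^sub>E j\<in>J. E j). c)"
        using sub C_eq by (intro sum.cong) auto
      also have "\<dots> = (\<Prod>j\<in>J. real (card (E j))) * c"
        using J(1) by (simp add: card_PiE of_nat_prod)
      finally show ?thesis .
    qed
    have "{\<omega> \<in> (\<Pi>\<^sub>E i\<in>I. carrier (G i)). \<forall>j\<in>J. \<omega> j \<in> carrier (G j)} = space P"
      using J(2) by (auto simp: spP)
    hence "(\<Prod>j\<in>J. real (card (carrier (G j)))) * c = 1"
      using sum_C[of "\<lambda>j. carrier (G j)"] P.prob_space by simp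
    hence "c = 1 / (\<Prod>j\<in>J. real (card (carrier (G j))))"
      by (metis mult.commute mult_zero_left nonzero_eq_divide_eq zero_neq_one mult_zero_right)
    hence "P.prob {\<omega> \<in> (\<Pi>\<^sub>E i\<in>I. carrier (G i)). \<forall>j\<in>J. \<omega> j \<in> F j}
        = (\<Prod>j\<in>J. real (card (F j)) / real (card (carrier (G j))))"
      using sum_C[of F] J(3) by (simp add: prod_dividef)
    thus "emeasure P {\<omega> \<in> (\<Pi>\<^sub>E i\<in>I. carrier (G i)). \<forall>j\<in>J. \<omega> j \<in> F j}
        = (\<Prod>j\<in>J. ennreal (card (F j) / card (carrier (G j))))"
      by (simp add: P.emeasure_eq_measure prod_ennreal)
  qed
  show ?thesis
    unfolding normalized_haar_def
  proof (rule the_equality)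
    show "prob_space ?Q \<and> sets ?Q = sets (\<Pi>\<^sub>M i\<in>I. count_space (carrier (G i))) \<and>
       (\<forall>g \<in> carrier (product_group I G). distr ?Q ?Q (?t g) = ?Q)"
      using Q inv sets_PiM_uniform[of I "\<lambda>i. carrier (G i)"] by (simp only: carrier_product_group) blast
  next
    fix P
    assume "prob_space P \<and> sets P = sets (\<Pi>\<^sub>M i\<in>I. count_space (carrier (G i))) \<and>
       (\<forall>g \<in> carrier (product_group I G). distr P P (?t g) = P)"
    thus "P = ?Q"
      using sets_PiM_uniform[of I "\<lambda>i. carrier (G i)"] by (intro uniq) (auto simp only: carrier_product_group)
  qed
qed

section \<open>The sequences and the measures attached to \<open>a\<close>\<close>

text \<open>Only the values \<open>a k\<close> with \<open>k \<ge> 1\<close> are used below.\<close>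

definition b_seq :: "(nat \<Rightarrow> nat) \<Rightarrow> nat \<Rightarrow> nat" where
  "b_seq a k = (a k)\<^sup>2"

definition eta_seq :: "(nat \<Rightarrow> nat) \<Rightarrow> nat \<Rightarrow> int" where
  "eta_seq a = (\<lambda>n\<in>{1..}. if \<exists>k\<ge>1. b_seq a k dvd n then 0 else 1)"

definition delta_seq :: "(nat \<Rightarrow> nat) \<Rightarrow> nat \<Rightarrow> nat" where
  "delta_seq a n = card {k. k \<ge> 1 \<and> a k dvd n}"

definition pi_seq :: "(nat \<Rightarrow> nat) \<Rightarrow> nat \<Rightarrow> int" where
  "pi_seq a = (\<lambda>n\<in>{1..}. (-1) ^ delta_seq a n)"

definition mu_seq :: "(nat \<Rightarrow> nat) \<Rightarrow> nat \<Rightarrow> int" where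
  "mu_seq a = (\<lambda>n\<in>{1..}. eta_seq a n * pi_seq a n)"

definition bernoulli_measure :: "(nat \<Rightarrow> int) measure" where
  "bernoulli_measure = (\<Pi>\<^sub>M n\<in>{1..}. uniform_count_measure {-1, 1})"

definition Omega_haar :: "(nat \<Rightarrow> nat) \<Rightarrow> (nat \<Rightarrow> int) measure" where
  "Omega_haar a = normalized_haar {1..} (\<lambda>k. integer_mod_group (b_seq a k))"

definition phi :: "(nat \<Rightarrow> nat) \<Rightarrow> (nat \<Rightarrow> int) \<Rightarrow> (nat \<Rightarrow> int)" where
  "phi a \<omega> = (\<lambda>n\<in>{1..}. if \<exists>k\<ge>1. [\<omega> k + int n = 0] (mod int (b_seq a k)) then 0 else 1)"

definition nu_B :: "(nat \<Rightarrow> nat) \<Rightarrow> (nat \<Rightarrow> int) measure" where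
  "nu_B a = distr (Omega_haar a) (seq_algebra {0, 1}) (phi a)"

definition nu_M :: "(nat \<Rightarrow> nat) \<Rightarrow> (nat \<Rightarrow> int) measure" where
  "nu_M a = distr (nu_B a \<Otimes>\<^sub>M bernoulli_measure) (seq_algebra {-1, 0, 1})
     (\<lambda>(x, y). \<lambda>n\<in>{1..}. x n * y n)"

definition chowla_property :: "(nat \<Rightarrow> int) \<Rightarrow> bool" where
  "chowla_property z \<longleftrightarrow>
     (\<forall>r\<ge>1. \<forall>s i :: nat \<Rightarrow> nat.
        strict_mono_on {1..r} s \<longrightarrow> (\<forall>j\<in>{1..r}. i j \<in> {1, 2}) \<longrightarrow> (\<exists>j\<in>{1..r}. i j \<noteq> 2) \<longrightarrow>
        (\<lambda>N. real_of_int (\<Sum>n=1..N. \<Prod>j=1..r. z (n + s j) ^ i j) / real N) \<longlonglongrightarrow> 0)"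

end

theory Submission
  imports Defs
begin

text \<open>
  On \<open>{-1, 0, 1}\<close> genericity is equivalent to convergence of the averages of all monomials
  \<open>\<Prod>\<^sub>j z\<^bsub>n+j\<^esub>\<^bsup>e\<^sub>j\<^esup>\<close> with \<open>e\<^sub>j \<in> {1, 2}\<close>. Under \<open>nu_M\<close> such a moment vanishes if some
  exponent is 1, so the Chowla property is the part of genericity that concerns these monomials;
  the purely quadratic ones always have the right limit. Indeed truncating \<open>\<B>\<close> to
  \<open>b\<^sub>1, \<dots>, b\<^sub>K\<close> gives a periodic sequence whose mean is computed on \<open>\<Omega>\<close> by the Chinese
  remainder theorem, and the truncation error is controlled by \<open>\<Sum>\<^bsub>k>K\<^esub> 1/b\<^sub>k\<close>. The same truncation
  reduces (i) \<open>\<Longrightarrow>\<close> (iii) to the vanishing of correlations between a periodic sequence and a product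
  of shifts of \<open>\<pi>\<close>, which follows from a van der Corput argument.
\<close>

section \<open>Averages\<close>

text \<open>Indices start at 0, so positions in a sequence on \<open>{1..}\<close> are written
  \<open>n + j\<close> with offset \<open>j \<ge> 1\<close>; this fits both orbit averages and the
  Chowla sums.\<close>

definition avg :: "(nat \<Rightarrow> real) \<Rightarrow> nat \<Rightarrow> real" where
  "avg f N = (\<Sum>n<N. f n) / real N"

lemma avg_cong: "(\<And>n. f n = g n) \<Longrightarrow> avg f = avg g"
  by (simp add: avg_def fun_eq_iff)

lemma avg_lincomb: "avg (\<lambda>n. \<Sum>i\<in>A. c i * f i n) N = (\<Sum>i\<in>A. c i * avg (f i) N)"
proof -
  have "(\<Sum>n<N. \<Sum>i\<in>A. c i * f i n) = (\<Sum>i\<in>A. c i * (\<Sum>n<N. f i n))"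
    by (subst sum.swap) (simp add: sum_distrib_left)
  thus ?thesis by (simp add: avg_def sum_divide_distrib[where A = A])
qed

lemma tendsto_avg_lincomb:
  assumes "\<And>i. i \<in> A \<Longrightarrow> avg (f i) \<longlonglongrightarrow> l i"
  shows "avg (\<lambda>n. \<Sum>i\<in>A. c i * f i n) \<longlonglongrightarrow> (\<Sum>i\<in>A. c i * l i)"
  unfolding avg_lincomb by (intro tendsto_sum tendsto_mult tendsto_const assms)

lemma bounded_div_nat_tendsto_zero:
  assumes "\<And>N. \<bar>D N\<bar> \<le> (C::real)"
  shows "(\<lambda>N. D N / real N) \<longlonglongrightarrow> 0"
proof (rule Lim_null_comparison)
  show "\<forall>\<^sub>F N in sequentially. norm (D N / real N) \<le> C / real N"
    using assms by (auto intro!: always_eventually divide_right_mono)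
  show "(\<lambda>N. C / real N) \<longlonglongrightarrow> 0" by (rule lim_const_over_n)
qed

lemma periodic_add_mult:
  assumes "\<And>n. f (n + p) = f n"
  shows "f (n + h * p) = f (n :: nat)"
proof (induction h)
  case (Suc h)
  have "f (n + Suc h * p) = f (n + h * p + p)" by (simp add: ac_simps)
  thus ?case using assms Suc.IH by metis
qed simp

text \<open>The deviation \<open>D N\<close> of the partial sums from linear growth is itself
  \<open>p\<close>-periodic. It therefore takes finitely many values, is bounded, and disappears
  after division by \<open>N\<close>.\<close>

lemma avg_periodic:
  assumes p: "p > 0" and per: "\<And>n. f (n + p) = f n"
  shows "avg f \<longlonglongrightarrow> (\<Sum>n<p. f n) / real p"
proof -
  define S where "S = (\<Sum>n<p. f n)"
  define D where "D = (\<lambda>N. (\<Sum>n<N. f n) - real N * (S / real p))"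
  have shift: "(\<Sum>n<N + p. f n) = (\<Sum>n<N. f n) + S" for N
  proof (induction N)
    case (Suc N)
    thus ?case by (simp add: per)
  qed (simp add: S_def)
  have "D (N + p) = D N" for N
    using p unfolding D_def shift by (simp add: field_simps)
  hence Dper: "D (N mod p + (N div p) * p) = D (N mod p)" for N by (rule periodic_add_mult)
  have "\<bar>D N\<bar> \<le> (\<Sum>r<p. \<bar>D r\<bar>)" for N
    using Dper[of N] p by (auto intro!: member_le_sum[of "N mod p" "{..<p}" "\<lambda>r. \<bar>D r\<bar>"])
  hence "(\<lambda>N. D N / real N + S / real p) \<longlonglongrightarrow> 0 + S / real p"
    by (intro tendsto_add bounded_div_nat_tendsto_zero tendsto_const)
  moreover have "\<forall>\<^sub>F N in sequentially. D N / real N + S / real p = avg f N"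
    using eventually_gt_at_top[of 0] by eventually_elim (use p in \<open>simp add: D_def avg_def field_simps\<close>)
  ultimately show ?thesis by (auto simp: S_def intro: Lim_transform_eventually)
qed

text \<open>Moving the window by one step replaces a single term by another, at a cost of at most
  \<open>2 * C\<close>; \<open>m\<close> steps cost a constant independent of
  \<open>N\<close>.\<close>

lemma avg_shift:
  assumes C: "\<And>n. \<bar>f n\<bar> \<le> C"
  shows "(\<lambda>N. avg (\<lambda>n. f (n + m)) N - avg f N) \<longlonglongrightarrow> 0"
proof -
  have "\<bar>(\<Sum>n<N. f (n + m)) - (\<Sum>n<N. f n)\<bar> \<le> 2 * C * real m" for N
  proof (induction m)
    case (Suc m)
    have "(\<Sum>n<N. f (n + Suc m)) - (\<Sum>n<N. f (n + m)) = f (N + m) - f m"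
      using sum_lessThan_telescope[of "\<lambda>n. f (n + m)" N] by (simp add: sum_subtractf)
    thus ?case using Suc.IH C[of "N + m"] C[of m] by (simp add: algebra_simps)
  qed simp
  from bounded_div_nat_tendsto_zero[of "\<lambda>N. (\<Sum>n<N. f (n + m)) - (\<Sum>n<N. f n)", OF this]
  show ?thesis by (simp add: avg_def diff_divide_distrib)
qed

lemma tendsto_avg_shift:
  assumes "\<And>n. \<bar>f n\<bar> \<le> C" "avg f \<longlonglongrightarrow> l"
  shows "avg (\<lambda>n. f (n + m)) \<longlonglongrightarrow> l"
  using tendsto_add[OF avg_shift[of f C m, OF assms(1)] assms(2)] by simp

section \<open>Correlations with periodic sequences\<close>

lemma avg_square_le: "(avg g N)\<^sup>2 \<le> avg (\<lambda>n. (g n)\<^sup>2) N"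
proof (cases "N = 0")
  case False
  have "(\<Sum>n<N. g n)\<^sup>2 \<le> real N * (\<Sum>n<N. (g n)\<^sup>2)"
    using Cauchy_Schwarz_ineq_sum[of "\<lambda>_. 1" g "{..<N}"] by simp
  thus ?thesis using False by (simp add: avg_def field_simps power2_eq_square)
qed (simp add: avg_def)

text \<open>
  A van der Corput argument: replacing \<open>F n\<close> by the mean of \<open>F (n + h p)\<close> over \<open>h < H\<close> changes
  the average of \<open>f F\<close> by \<open>o(1)\<close>, and by Cauchy--Schwarz what remains is at most \<open>1 / \<surd>H\<close>.
\<close>

lemma avg_periodic_mult_tendsto_zero:
  assumes per: "\<And>n. f (n + p) = f n" and f1: "\<And>n. \<bar>f n\<bar> \<le> 1"
    and F1: "\<And>n. (F n)\<^sup>2 = 1"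
    and cor: "\<And>h. h \<ge> 1 \<Longrightarrow> avg (\<lambda>n. F n * F (n + h * p)) \<longlonglongrightarrow> 0"
  shows "avg (\<lambda>n. f n * F n) \<longlonglongrightarrow> 0"
proof -
  have Fabs: "\<bar>F n\<bar> = 1" for n using F1[of n] by (simp add: abs_square_eq_1)
  have fF: "\<bar>f n * F n\<bar> \<le> 1" for n using f1[of n] by (simp add: abs_mult Fabs)
  \<comment> \<open>The translates of \<open>F\<close> by multiples of \<open>p\<close> are
    asymptotically orthonormal: off the diagonal the smaller shift is factored out and
    \<open>cor\<close> applies to the difference, while on the diagonal \<open>F1\<close> gives the
    constant 1.\<close>
  have cor2: "avg (\<lambda>n. F (n + h * p) * F (n + h' * p)) \<longlonglongrightarrow> of_bool (h = h')" for h h'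
  proof (cases h h' rule: linorder_cases)
    case less
    define d where "d = h' - h"
    have "avg (\<lambda>n. (\<lambda>n. F n * F (n + d * p)) (n + h * p)) \<longlonglongrightarrow> 0"
      by (rule tendsto_avg_shift[where C = 1]) (use less cor in \<open>auto simp: abs_mult Fabs d_def\<close>)
    moreover have "h' = h + d" using less by (simp add: d_def)
    ultimately show ?thesis using less by (simp add: distrib_right add.assoc)
  next
    case greater
    define d where "d = h - h'"
    have "avg (\<lambda>n. (\<lambda>n. F n * F (n + d * p)) (n + h' * p)) \<longlonglongrightarrow> 0"
      by (rule tendsto_avg_shift[where C = 1]) (use greater cor in \<open>auto simp: abs_mult Fabs d_def\<close>)
    moreover have "h = h' + d" using greater by (simp add: d_def)
    ultimately have "avg (\<lambda>n. F (n + h' * p) * F (n + h * p)) \<longlonglongrightarrow> 0" by (simp add: distrib_right add.assoc)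
    thus ?thesis using greater by (subst mult.commute) simp
  next
    case equal
    have "avg (\<lambda>n. F (n + h * p) * F (n + h' * p)) = avg (\<lambda>_. 1)"
      by (rule avg_cong) (use equal F1 in \<open>simp flip: power2_eq_square\<close>)
    thus ?thesis using avg_periodic[of 1 "\<lambda>_. 1"] equal by simp
  qed
  \<comment> \<open>With \<open>u\<close> the average of \<open>f G\<close> and \<open>v\<close>
    that of \<open>f F\<close>, the bound is \<open>v^2 \<le> 2 * u^2 + 2 * (u - v)^2\<close>.
    Eventually \<open>u^2\<close> is below \<open>2 / H\<close> and \<open>(u - v)^2\<close> below
    \<open>1 / (2 * H)\<close>, which gives \<open>4 / H + 1 / H\<close>.\<close>
  have main: "\<forall>\<^sub>F N in sequentially. (avg (\<lambda>n. f n * F n) N)\<^sup>2 < 5 / real H" if H: "H \<ge> 1" for H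
  proof -
    define G where "G = (\<lambda>n. \<Sum>h<H. 1 / real H * F (n + h * p))"
    \<comment> \<open>Since \<open>h * p\<close> is a multiple of the period,
      \<open>f n * F (n + h * p)\<close> is the product \<open>f F\<close> evaluated at
      \<open>n + h * p\<close>, so this is a pure window shift.\<close>
    have "(\<lambda>N. avg (\<lambda>n. f n * F (n + h * p)) N - avg (\<lambda>n. f n * F n) N) \<longlonglongrightarrow> 0" for h
      using avg_shift[of "\<lambda>n. f n * F n" 1 "h * p"] fF periodic_add_mult[of f p, OF per] by simp
    hence "(\<lambda>N. \<Sum>h<H. 1 / real H * (avg (\<lambda>n. f n * F (n + h * p)) N - avg (\<lambda>n. f n * F n) N))
             \<longlonglongrightarrow> (\<Sum>h<H. 1 / real H * 0)"
      by (intro tendsto_sum tendsto_mult tendsto_const)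
    moreover have "(\<Sum>h<H. 1 / real H * (avg (\<lambda>n. f n * F (n + h * p)) N - avg (\<lambda>n. f n * F n) N))
       = avg (\<lambda>n. f n * G n) N - avg (\<lambda>n. f n * F n) N" for N
    proof -
      have eq: "avg (\<lambda>n. f n * G n) = avg (\<lambda>n. \<Sum>h<H. 1 / real H * (f n * F (n + h * p)))"
        by (rule avg_cong) (simp add: G_def sum_distrib_left)
      show ?thesis unfolding eq avg_lincomb using H by (simp add: right_diff_distrib sum_subtractf)
    qed
    ultimately have "(\<lambda>N. avg (\<lambda>n. f n * G n) N - avg (\<lambda>n. f n * F n) N) \<longlonglongrightarrow> 0" by simp
    hence "(\<lambda>N. (avg (\<lambda>n. f n * G n) N - avg (\<lambda>n. f n * F n) N)\<^sup>2) \<longlonglongrightarrow> 0\<^sup>2" by (intro tendsto_power)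
    hence e1: "\<forall>\<^sub>F N in sequentially. (avg (\<lambda>n. f n * G n) N - avg (\<lambda>n. f n * F n) N)\<^sup>2 < 1 / (2 * real H)"
      by (rule order_tendstoD(2)) (use H in simp)
    \<comment> \<open>Expansion of \<open>(G n)^2\<close> into pairs: in the limit only the
      \<open>H\<close> diagonal pairs survive, each with weight \<open>1 / H^2\<close>.\<close>
    have "avg (\<lambda>n. \<Sum>(h,h')\<in>{..<H}\<times>{..<H}. 1 / (real H)\<^sup>2 * (F (n + h * p) * F (n + h' * p)))
       \<longlonglongrightarrow> (\<Sum>(h,h')\<in>{..<H}\<times>{..<H}. 1 / (real H)\<^sup>2 * of_bool (h = h'))"
      unfolding case_prod_beta by (intro tendsto_avg_lincomb cor2)
    also have "(\<Sum>(h,h')\<in>{..<H}\<times>{..<H}. 1 / (real H)\<^sup>2 * of_bool (h = h')) = 1 / real H"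
      using H by (simp only: sum.cartesian_product[symmetric] sum_distrib_left[symmetric])
        (simp add: of_bool_def power2_eq_square)
    also have "avg (\<lambda>n. \<Sum>(h,h')\<in>{..<H}\<times>{..<H}. 1 / (real H)\<^sup>2 * (F (n + h * p) * F (n + h' * p)))
        = avg (\<lambda>n. (G n)\<^sup>2)"
      by (rule avg_cong)
        (simp add: G_def power2_eq_square sum_product sum.cartesian_product[symmetric] mult_ac)
    finally have "avg (\<lambda>n. (G n)\<^sup>2) \<longlonglongrightarrow> 1 / real H" .
    hence e2: "\<forall>\<^sub>F N in sequentially. avg (\<lambda>n. (G n)\<^sup>2) N < 2 / real H"
      by (rule order_tendstoD(2)) (use H in \<open>simp add: divide_strict_right_mono\<close>)
    from e1 e2 show ?thesis
    proof eventually_elim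
      case (elim N)
      have "(avg (\<lambda>n. f n * G n) N)\<^sup>2 \<le> avg (\<lambda>n. (f n * G n)\<^sup>2) N" by (rule avg_square_le)
      also have "\<dots> \<le> avg (\<lambda>n. (G n)\<^sup>2) N"
      proof -
        have "(f n)\<^sup>2 \<le> 1" for n using f1[of n] by (simp add: abs_square_le_1)
        hence "(f n * G n)\<^sup>2 \<le> (G n)\<^sup>2" for n
          by (simp add: power_mult_distrib mult_left_le_one_le)
        thus ?thesis unfolding avg_def by (intro divide_right_mono sum_mono) auto
      qed
      finally have "(avg (\<lambda>n. f n * G n) N)\<^sup>2 < 2 / real H" using elim(2) by linarith
      moreover have "v\<^sup>2 \<le> 2 * u\<^sup>2 + 2 * (u - v)\<^sup>2" for u v :: real
      proof -
        have "2 * u\<^sup>2 + 2 * (u - v)\<^sup>2 - v\<^sup>2 = (2 * u - v)\<^sup>2" by (simp add: power2_eq_square algebra_simps)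
        thus ?thesis by (metis diff_ge_0_iff_ge zero_le_power2)
      qed
      ultimately have "(avg (\<lambda>n. f n * F n) N)\<^sup>2 < 2 * (2 / real H) + 2 * (1 / (2 * real H))"
        using elim(1) by (smt (verit, best))
      thus ?case by (simp add: field_simps)
    qed
  qed
  have "(\<lambda>N. (avg (\<lambda>n. f n * F n) N)\<^sup>2) \<longlonglongrightarrow> 0"
  proof (rule order_tendstoI)
    fix e :: real assume e: "0 < e"
    obtain H :: nat where H: "5 / e < real H" using reals_Archimedean2 by blast
    have H1: "H \<ge> 1"
    proof (rule ccontr)
      assume "\<not> H \<ge> 1"
      moreover have "0 < 5 / e" using e by simp
      ultimately show False using H by simp
    qed
    have "5 / real H < e" using H H1 e by (simp add: divide_less_eq mult.commute)
    thus "\<forall>\<^sub>F N in sequentially. (avg (\<lambda>n. f n * F n) N)\<^sup>2 < e"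
      using main[OF H1] by (auto elim!: eventually_mono)
  qed (auto intro!: always_eventually intro: less_le_trans)
  thus ?thesis by simp
qed

text \<open>Interchange of the limits in \<open>K\<close> and \<open>N\<close> by a three-term
  estimate. The range of \<open>N\<close> on which the error \<open>e K\<close> is guaranteed may
  depend on \<open>K\<close>, because \<open>K\<close> is fixed before \<open>N\<close>
  grows.\<close>

lemma tendsto_approx:
  fixes v :: "nat \<Rightarrow> real"
  assumes u: "\<And>K. u K \<longlonglongrightarrow> L K" and L: "L \<longlonglongrightarrow> l" and e: "e \<longlonglongrightarrow> 0"
    and uv: "\<And>K. \<forall>\<^sub>F N in sequentially. \<bar>u K N - v N\<bar> \<le> e K"
  shows "v \<longlonglongrightarrow> l"
proof (rule tendstoI)
  fix d :: real assume d: "0 < d"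
  have "\<forall>\<^sub>F K in sequentially. \<bar>L K - l\<bar> < d / 3 \<and> e K < d / 3"
    using tendstoD[OF L, of "d / 3"] order_tendstoD(2)[OF e, of "d / 3"] d
    by (auto simp: dist_real_def intro: eventually_conj)
  then obtain K where K: "\<bar>L K - l\<bar> < d / 3" "e K < d / 3" by (auto simp: eventually_sequentially)
  have "\<forall>\<^sub>F N in sequentially. \<bar>u K N - L K\<bar> < d / 3"
    using tendstoD[OF u, of "d / 3" K] d by (simp add: dist_real_def)
  with uv[of K] show "\<forall>\<^sub>F N in sequentially. dist (v N) l < d"
    by eventually_elim (use K in \<open>unfold dist_real_def, linarith\<close>)
qed

section \<open>Genericity and moments\<close>

lemma shift_funpow:
  assumes "x \<in> seq_space \<Gamma>"
  shows "(shift ^^ n) x \<in> seq_space \<Gamma>" and "m \<ge> 1 \<Longrightarrow> (shift ^^ n) x m = x (n + m)"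
proof (induction n arbitrary: m)
  case (Suc n)
  { case 1 show ?case using Suc.IH(1) by (auto simp: seq_space_def shift_def PiE_iff extensional_def) }
  { case 2 thus ?case using Suc.IH(2)[of "m + 1"] by (simp add: shift_def) }
qed (use assms in auto)

lemma seq_spaceD: "x \<in> seq_space \<Gamma> \<Longrightarrow> m \<ge> 1 \<Longrightarrow> x m \<in> \<Gamma>"
  by (auto simp: seq_space_def)

lemma space_seq_algebra: "space (seq_algebra \<Gamma>) = seq_space \<Gamma>"
  by (simp add: seq_algebra_def seq_space_def space_PiM)

lemma measurable_coordinate:
  assumes "j \<ge> 1"
  shows "(\<lambda>\<omega>. g (\<omega> j) :: real) \<in> borel_measurable (seq_algebra \<Gamma>)"
  unfolding seq_algebra_def
  by (rule measurable_compose[OF measurable_component_singleton]) (use assms in auto)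

lemma measurable_coordinate_prod:
  assumes "J \<subseteq> {1..}"
  shows "(\<lambda>\<omega>. \<Prod>j\<in>J. g j (\<omega> j) :: real) \<in> borel_measurable (seq_algebra \<Gamma>)"
  by (intro borel_measurable_prod measurable_coordinate) (use assms in auto)

lemma indicator_cylinder:
  assumes "x \<in> seq_space \<Gamma>" "finite J"
  shows "indicator (cylinder \<Gamma> J w) x = (\<Prod>j\<in>J. of_bool (x j = w j) :: real)"
  using assms by (auto simp: indicator_def cylinder_def)

text \<open>The cylinder is the level set at 1 of a measurable product of coordinate
  indicators.\<close>

lemma sets_cylinder:
  assumes "finite J" "J \<subseteq> {1..}"
  shows "cylinder \<Gamma> J w \<in> sets (seq_algebra \<Gamma>)"
proof -
  have "{\<omega> \<in> space (seq_algebra \<Gamma>). (\<Prod>j\<in>J. of_bool (\<omega> j = w j)) = (1 :: real)} \<in> sets (seq_algebra \<Gamma>)"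
    using measurable_coordinate_prod[OF assms(2), of "\<lambda>j v. of_bool (v = w j)"] by measurable
  also have "{\<omega> \<in> space (seq_algebra \<Gamma>). (\<Prod>j\<in>J. of_bool (\<omega> j = w j)) = (1 :: real)} = cylinder \<Gamma> J w"
    by (auto simp: space_seq_algebra indicator_cylinder[OF _ assms(1), symmetric] indicator_eq_1_iff)
      (auto simp: cylinder_def)
  finally show ?thesis .
qed

text \<open>The cylinders over \<open>J\<close> partition the sequence space and the product is
  constant on each of them. The sum over words \<open>w\<close> is evaluated by factoring it into
  one sum over \<open>\<Gamma>\<close> per coordinate.\<close>

lemma prod_eq_sum_cylinders:
  assumes "finite \<Gamma>" "finite J" "J \<subseteq> {1..}" "x \<in> seq_space \<Gamma>"
  shows "(\<Prod>j\<in>J. g j (x j)) =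
    (\<Sum>w\<in>J \<rightarrow>\<^sub>E \<Gamma>. (\<Prod>j\<in>J. g j (w j)) * indicator (cylinder \<Gamma> J w) x :: real)"
proof -
  have "(\<Sum>w\<in>J \<rightarrow>\<^sub>E \<Gamma>. (\<Prod>j\<in>J. g j (w j)) * indicator (cylinder \<Gamma> J w) x) =
      (\<Sum>w\<in>J \<rightarrow>\<^sub>E \<Gamma>. \<Prod>j\<in>J. g j (w j) * of_bool (x j = w j))"
    using assms by (simp add: indicator_cylinder prod.distrib)
  also have "\<dots> = (\<Prod>j\<in>J. \<Sum>v\<in>\<Gamma>. g j v * of_bool (x j = v))"
    using assms by (subst prod_sum_PiE) auto
  also have "\<dots> = (\<Prod>j\<in>J. g j (x j))"
  proof (rule prod.cong)
    fix j assume "j \<in> J"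
    hence "x j \<in> \<Gamma>" using assms by (auto simp: seq_space_def)
    thus "(\<Sum>v\<in>\<Gamma>. g j v * of_bool (x j = v)) = g j (x j)"
      using assms(1) by (simp add: of_bool_def if_distrib[of "(*) _"] sum.delta cong: if_cong)
  qed simp
  finally show ?thesis by simp
qed

lemma cylinder_freq:
  assumes "x \<in> seq_space \<Gamma>" "finite J" "J \<subseteq> {1..}"
  shows "(\<lambda>N. (\<Sum>n<N. indicator (cylinder \<Gamma> J w) ((shift ^^ n) x)) / real N) =
     avg (\<lambda>n. \<Prod>j\<in>J. of_bool (x (n + j) = w j))"
proof -
  have "indicator (cylinder \<Gamma> J w) ((shift ^^ n) x) = (\<Prod>j\<in>J. of_bool (x (n + j) = w j) :: real)" for n
  proof -
    have "(\<Prod>j\<in>J. of_bool ((shift ^^ n) x j = w j) :: real) = (\<Prod>j\<in>J. of_bool (x (n + j) = w j))"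
      using assms by (intro prod.cong) (auto simp: shift_funpow(2)[OF assms(1)])
    thus ?thesis using indicator_cylinder[OF shift_funpow(1)[OF assms(1)] assms(2)] by simp
  qed
  thus ?thesis by (simp add: avg_def fun_eq_iff)
qed

lemma integral_coordinate_prod:
  assumes "prob_space \<nu>" "sets \<nu> = sets (seq_algebra \<Gamma>)" "finite \<Gamma>" "finite J" "J \<subseteq> {1..}"
  shows "(\<integral>\<omega>. (\<Prod>j\<in>J. g j (\<omega> j)) \<partial>\<nu>) =
    (\<Sum>w\<in>J \<rightarrow>\<^sub>E \<Gamma>. (\<Prod>j\<in>J. g j (w j)) * measure \<nu> (cylinder \<Gamma> J w))"
proof -
  interpret prob_space \<nu> by fact
  have sp: "space \<nu> = seq_space \<Gamma>" using sets_eq_imp_space_eq[OF assms(2)] by (simp add: space_seq_algebra)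
  have cyl: "cylinder \<Gamma> J w \<in> sets \<nu>" for w using assms by (simp add: sets_cylinder)
  have "(\<integral>\<omega>. (\<Prod>j\<in>J. g j (\<omega> j)) \<partial>\<nu>) =
     (\<integral>\<omega>. (\<Sum>w\<in>J \<rightarrow>\<^sub>E \<Gamma>. (\<Prod>j\<in>J. g j (w j)) * indicator (cylinder \<Gamma> J w) \<omega>) \<partial>\<nu>)"
    by (rule Bochner_Integration.integral_cong) (use assms prod_eq_sum_cylinders sp in auto)
  also have "\<dots> = (\<Sum>w\<in>J \<rightarrow>\<^sub>E \<Gamma>. (\<Prod>j\<in>J. g j (w j)) * measure \<nu> (cylinder \<Gamma> J w))"
  proof -
    have "cylinder \<Gamma> J w \<inter> space \<nu> = cylinder \<Gamma> J w" for w using sp by (auto simp: cylinder_def)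
    thus ?thesis using cyl by (subst Bochner_Integration.integral_sum) (auto intro!: integrable_real_indicator emeasure_finite simp: less_top[symmetric])
  qed
  finally show ?thesis .
qed

text \<open>Genericity is defined through cylinders only; it extends by linearity to products of
  one-coordinate functions, which are finite combinations of cylinder indicators. The later uses
  take powers for \<open>g\<close>.\<close>

lemma generic_avg:
  assumes "generic \<Gamma> x \<nu>" "finite \<Gamma>" "finite J" "J \<subseteq> {1..}"
  shows "avg (\<lambda>n. \<Prod>j\<in>J. g j (x (n + j))) \<longlonglongrightarrow> (\<integral>\<omega>. (\<Prod>j\<in>J. g j (\<omega> j)) \<partial>\<nu>)"
proof -
  have x: "x \<in> seq_space \<Gamma>" and \<nu>: "prob_space \<nu>" "sets \<nu> = sets (seq_algebra \<Gamma>)"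
    using assms(1) by (auto simp: generic_def)
  have lim: "avg (\<lambda>n. indicator (cylinder \<Gamma> J w) ((shift ^^ n) x)) \<longlonglongrightarrow> measure \<nu> (cylinder \<Gamma> J w)"
    if "w \<in> J \<rightarrow>\<^sub>E \<Gamma>" for w
  proof -
    have "w \<in> J \<rightarrow> \<Gamma>" using that by auto
    thus ?thesis using assms unfolding generic_def avg_def[abs_def] by blast
  qed
  have "avg (\<lambda>n. \<Prod>j\<in>J. g j (x (n + j))) = avg (\<lambda>n. \<Prod>j\<in>J. g j ((shift ^^ n) x j))"
    by (intro avg_cong prod.cong) (use assms(4) shift_funpow(2)[OF x] in auto)
  also have "\<dots> = avg (\<lambda>n. \<Sum>w\<in>J \<rightarrow>\<^sub>E \<Gamma>. (\<Prod>j\<in>J. g j (w j)) * indicator (cylinder \<Gamma> J w) ((shift ^^ n) x))"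
    by (intro avg_cong prod_eq_sum_cylinders shift_funpow(1) assms x)
  also have "\<dots> \<longlonglongrightarrow> (\<Sum>w\<in>J \<rightarrow>\<^sub>E \<Gamma>. (\<Prod>j\<in>J. g j (w j)) * measure \<nu> (cylinder \<Gamma> J w))"
    by (intro tendsto_avg_lincomb lim)
  finally show ?thesis by (subst integral_coordinate_prod[OF \<nu> assms(2-4)])
qed

text \<open>On \<open>{-1, 0, 1}\<close> the indicator of a point is a quadratic polynomial.\<close>

lemma genericI_moments:
  assumes x: "x \<in> seq_space {-1, 0, 1}"
    and \<nu>: "prob_space \<nu>" "sets \<nu> = sets (seq_algebra {-1, 0, 1})"
    and lim: "\<And>J e. finite J \<Longrightarrow> J \<subseteq> {1..} \<Longrightarrow> (\<And>j. j \<in> J \<Longrightarrow> e j \<in> {1, 2}) \<Longrightarrow>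
      avg (\<lambda>n. \<Prod>j\<in>J. real_of_int (x (n + j)) ^ e j) \<longlonglongrightarrow> (\<integral>\<omega>. (\<Prod>j\<in>J. real_of_int (\<omega> j) ^ e j) \<partial>\<nu>)"
  shows "generic {-1, 0, 1} x \<nu>"
  unfolding generic_def
proof (intro conjI allI impI x \<nu>)
  let ?\<Gamma> = "{-1, 0, 1 :: int}"
  fix J :: "nat set" and w :: "nat \<Rightarrow> int"
  assume J: "finite J" "J \<subseteq> {1..}" and w: "w \<in> J \<rightarrow> ?\<Gamma>"
  interpret prob_space \<nu> by fact
  have sp: "space \<nu> = seq_space ?\<Gamma>" using sets_eq_imp_space_eq[OF \<nu>(2)] by (simp add: space_seq_algebra)
  \<comment> \<open>Coefficients of the interpolation polynomials on \<open>{-1, 0, 1}\<close>: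
    \<open>1 - u^2\<close> for the point 0 and \<open>(u^2 + v * u) / 2\<close> for
    \<open>v = 1\<close> or \<open>v = -1\<close>.\<close>
  define c :: "int \<Rightarrow> nat \<Rightarrow> real" where
    "c v e = (if v = 0 then (if e = 0 then 1 else if e = 1 then 0 else -1)
              else (if e = 0 then 0 else if e = 1 then v / 2 else 1 / 2))" for v e
  have poly: "of_bool (u = v) = (\<Sum>e\<in>{0, 1, 2}. c v e * real_of_int u ^ e)"
    if "u \<in> ?\<Gamma>" "v \<in> ?\<Gamma>" for u v
    using that by (auto simp: c_def)
  have expand: "(\<Prod>j\<in>J. of_bool (y j = w j)) =
      (\<Sum>e\<in>J \<rightarrow>\<^sub>E {0, 1, 2}. (\<Prod>j\<in>J. c (w j) (e j)) * (\<Prod>j\<in>J. real_of_int (y j) ^ e j))"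
    if "\<And>j. j \<in> J \<Longrightarrow> y j \<in> ?\<Gamma>" for y
  proof -
    have "(\<Prod>j\<in>J. of_bool (y j = w j)) = (\<Prod>j\<in>J. \<Sum>e\<in>{0, 1, 2}. c (w j) e * real_of_int (y j) ^ e)"
      using that w by (intro prod.cong poly) auto
    also have "\<dots> = (\<Sum>e\<in>J \<rightarrow>\<^sub>E {0, 1, 2}. \<Prod>j\<in>J. c (w j) (e j) * real_of_int (y j) ^ e j)"
      using J by (subst prod_sum_PiE) auto
    finally show ?thesis by (simp add: prod.distrib)
  qed
  have lim': "avg (\<lambda>n. \<Prod>j\<in>J. real_of_int (x (n + j)) ^ e j)
      \<longlonglongrightarrow> (\<integral>\<omega>. (\<Prod>j\<in>J. real_of_int (\<omega> j) ^ e j) \<partial>\<nu>)" if e: "e \<in> J \<rightarrow>\<^sub>E {0, 1, 2}" for e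
  proof -
    \<comment> \<open>Expanding the polynomials also produces exponents 0, which \<open>lim\<close>
      does not cover. Their factors equal 1, so those indices are dropped, possibly leaving the
      empty set.\<close>
    let ?J = "{j \<in> J. e j \<noteq> 0}"
    have restr: "(\<Prod>j\<in>J. y j ^ e j) = (\<Prod>j\<in>?J. y j ^ e j)" for y :: "nat \<Rightarrow> real"
      using J(1) by (intro prod.mono_neutral_right) auto
    have "e j \<in> {1, 2}" if "j \<in> ?J" for j using PiE_mem[OF e, of j] that by auto
    thus ?thesis unfolding restr using J by (intro lim) auto
  qed
  have "avg (\<lambda>n. \<Sum>e\<in>J \<rightarrow>\<^sub>E {0, 1, 2}. (\<Prod>j\<in>J. c (w j) (e j)) * (\<Prod>j\<in>J. real_of_int (x (n + j)) ^ e j))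
     \<longlonglongrightarrow> (\<Sum>e\<in>J \<rightarrow>\<^sub>E {0, 1, 2}. (\<Prod>j\<in>J. c (w j) (e j)) * (\<integral>\<omega>. (\<Prod>j\<in>J. real_of_int (\<omega> j) ^ e j) \<partial>\<nu>))"
    by (intro tendsto_avg_lincomb lim')
  also have "avg (\<lambda>n. \<Sum>e\<in>J \<rightarrow>\<^sub>E {0, 1, 2}. (\<Prod>j\<in>J. c (w j) (e j)) * (\<Prod>j\<in>J. real_of_int (x (n + j)) ^ e j))
      = avg (\<lambda>n. \<Prod>j\<in>J. of_bool (x (n + j) = w j))"
    by (intro avg_cong expand[symmetric]) (rule seq_spaceD[OF x], use J in \<open>auto simp: subset_eq intro: trans_le_add2\<close>)
  also have "(\<Sum>e\<in>J \<rightarrow>\<^sub>E {0, 1, 2}. (\<Prod>j\<in>J. c (w j) (e j)) * (\<integral>\<omega>. (\<Prod>j\<in>J. real_of_int (\<omega> j) ^ e j) \<partial>\<nu>))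
      = measure \<nu> (cylinder ?\<Gamma> J w)"
  proof -
    have int: "integrable \<nu> (\<lambda>\<omega>. \<Prod>j\<in>J. real_of_int (\<omega> j) ^ e j)" for e
    proof (rule integrable_const_bound[where B = 1])
      show "(\<lambda>\<omega>. \<Prod>j\<in>J. real_of_int (\<omega> j) ^ e j) \<in> borel_measurable \<nu>"
        using measurable_coordinate_prod[OF J(2)] \<nu>(2) by (simp cong: measurable_cong_sets)
      show "AE \<omega> in \<nu>. norm (\<Prod>j\<in>J. real_of_int (\<omega> j) ^ e j) \<le> 1"
      proof (rule AE_I2)
        fix \<omega> assume "\<omega> \<in> space \<nu>"
        hence "\<bar>real_of_int (\<omega> j)\<bar> \<le> 1" if "j \<in> J" for j
          using seq_spaceD[of \<omega> ?\<Gamma> j] subsetD[OF J(2) that] by (auto simp: sp)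
        thus "norm (\<Prod>j\<in>J. real_of_int (\<omega> j) ^ e j) \<le> 1"
          unfolding prod_norm[symmetric] by (intro prod_le_1) (auto simp: power_abs intro: power_le_one)
      qed
    qed
    have "(\<Sum>e\<in>J \<rightarrow>\<^sub>E {0, 1, 2}. (\<Prod>j\<in>J. c (w j) (e j)) * (\<integral>\<omega>. (\<Prod>j\<in>J. real_of_int (\<omega> j) ^ e j) \<partial>\<nu>))
       = (\<integral>\<omega>. (\<Sum>e\<in>J \<rightarrow>\<^sub>E {0, 1, 2}. (\<Prod>j\<in>J. c (w j) (e j)) * (\<Prod>j\<in>J. real_of_int (\<omega> j) ^ e j)) \<partial>\<nu>)"
      using int by (subst Bochner_Integration.integral_sum) auto
    also have "\<dots> = (\<integral>\<omega>. indicator (cylinder ?\<Gamma> J w) \<omega> \<partial>\<nu>)"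
    proof (rule Bochner_Integration.integral_cong[OF refl])
      fix \<omega> assume \<omega>: "\<omega> \<in> space \<nu>"
      have "(\<Prod>j\<in>J. of_bool (\<omega> j = w j)) =
        (\<Sum>e\<in>J \<rightarrow>\<^sub>E {0, 1, 2}. (\<Prod>j\<in>J. c (w j) (e j)) * (\<Prod>j\<in>J. real_of_int (\<omega> j) ^ e j))"
        by (rule expand, rule seq_spaceD[OF \<omega>[unfolded sp]]) (use J in auto)
      thus "(\<Sum>e\<in>J \<rightarrow>\<^sub>E {0, 1, 2}. (\<Prod>j\<in>J. c (w j) (e j)) * (\<Prod>j\<in>J. real_of_int (\<omega> j) ^ e j))
          = indicator (cylinder ?\<Gamma> J w) \<omega>"
        using \<omega> J by (simp only: indicator_cylinder sp)
    qed
    also have "\<dots> = measure \<nu> (cylinder ?\<Gamma> J w)"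
    proof -
      have "cylinder ?\<Gamma> J w \<inter> space \<nu> = cylinder ?\<Gamma> J w" using sp by (auto simp: cylinder_def)
      thus ?thesis by simp
    qed
    finally show ?thesis .
  qed
  finally show "(\<lambda>N. (\<Sum>n<N. indicator (cylinder ?\<Gamma> J w) ((shift ^^ n) x)) / real N)
      \<longlonglongrightarrow> measure \<nu> (cylinder ?\<Gamma> J w)"
    using cylinder_freq[OF x J] by simp
qed

text \<open>Passes from increasing lists of shifts \<open>s j \<ge> 0\<close> with \<open>n\<close>
  starting at 1 to finite sets of offsets \<open>\<ge> 1\<close> with \<open>n\<close> starting at
  0. The offset belonging to \<open>s j\<close> is \<open>Suc (s j)\<close>, and an exponent other
  than 2 is 1.\<close>

lemma chowla_property_iff:
  "chowla_property z \<longleftrightarrow>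
     (\<forall>J e. finite J \<longrightarrow> J \<subseteq> {1..} \<longrightarrow> (\<forall>j\<in>J. e j \<in> {1, 2}) \<longrightarrow> (\<exists>j\<in>J. e j = 1) \<longrightarrow>
        avg (\<lambda>n. \<Prod>j\<in>J. real_of_int (z (n + j)) ^ e j) \<longlonglongrightarrow> 0)" (is "_ \<longleftrightarrow> ?R")
proof -
  have conv: "(\<lambda>N. real_of_int (\<Sum>n=1..N. \<Prod>j=1..r. z (n + s j) ^ i j) / real N)
      = avg (\<lambda>n. \<Prod>j=1..r. real_of_int (z (n + Suc (s j))) ^ i j)" for r s i
    by (simp add: avg_def fun_eq_iff sum.atLeast1_atMost_eq)
  show ?thesis
  proof (intro iffI allI impI)
    fix J :: "nat set" and e :: "nat \<Rightarrow> nat"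
    assume ch: "chowla_property z" and J: "finite J" "J \<subseteq> {1..}"
      and e: "\<forall>j\<in>J. e j \<in> {1, 2}" "\<exists>j\<in>J. e j = 1"
    obtain h where h: "bij_betw h {..<card J} J" "strict_mono_on {..<card J} h"
      using ex_bij_betw_strict_mono_card[OF J(1)] .
    \<comment> \<open>The enumeration \<open>h\<close> starts at 0 while the list starts at 1,
      whence \<open>j - 1\<close>; the outer \<open>- 1\<close> undoes the \<open>Suc\<close> of the
      offset and loses nothing because elements of \<open>J\<close> are positive.\<close>
    define s where "s j = h (j - 1) - 1" for j
    have hJ: "h m \<in> J" "h m \<ge> 1" if "m < card J" for m
      using bij_betwE[OF h(1)] that J(2) by auto
    have sh: "Suc (s j) = h (j - 1)" if "j \<in> {1..card J}" for j
      proof -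
      have "j - 1 < card J" using that by auto
      from hJ(2)[OF this] show ?thesis by (simp add: s_def)
    qed
    have s: "strict_mono_on {1..card J} s"
    proof (rule strict_mono_onI)
      fix p q assume pq: "p \<in> {1..card J}" "q \<in> {1..card J}" "p < q"
      hence "h (p - 1) < h (q - 1)" by (intro strict_mono_onD[OF h(2)]) auto
      thus "s p < s q" using sh pq by (metis Suc_less_eq)
    qed
    have bij: "bij_betw (\<lambda>j. Suc (s j)) {1..card J} J"
    proof -
      have "bij_betw (\<lambda>j. j - 1) {1..card J} {..<card J}"
        by (rule bij_betwI[where g = Suc]) auto
      hence "bij_betw (h \<circ> (\<lambda>j. j - 1)) {1..card J} J" using h(1) by (rule bij_betw_trans)
      thus ?thesis using sh by (subst bij_betw_cong[where g = "h \<circ> (\<lambda>j. j - 1)"]) auto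
    qed
    have c1: "card J \<ge> 1" using J e by (auto simp: Suc_le_eq card_gt_0_iff)
    have c2: "\<forall>j\<in>{1..card J}. e (Suc (s j)) \<in> {1, 2}" using e(1) bij_betwE[OF bij] by blast
    have c3: "\<exists>j\<in>{1..card J}. e (Suc (s j)) \<noteq> 2"
    proof -
      obtain m where m: "m \<in> J" "e m = 1" using e(2) by blast
      then obtain j where "j \<in> {1..card J}" "m = Suc (s j)"
        using bij unfolding bij_betw_def by (metis imageE)
      thus ?thesis using m by (intro bexI[of _ j]) auto
    qed
    have "avg (\<lambda>n. \<Prod>j=1..card J. real_of_int (z (n + Suc (s j))) ^ e (Suc (s j))) \<longlonglongrightarrow> 0"
      by (rule ch[unfolded chowla_property_def conv, THEN spec, THEN mp, OF c1, THEN spec, THEN spec,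
            of s "\<lambda>j. e (Suc (s j))", THEN mp, OF s, THEN mp, OF c2, THEN mp, OF c3])
    moreover have "(\<Prod>j=1..card J. real_of_int (z (n + Suc (s j))) ^ e (Suc (s j)))
        = (\<Prod>j\<in>J. real_of_int (z (n + j)) ^ e j)" for n
      by (rule prod.reindex_bij_betw[OF bij])
    ultimately show "avg (\<lambda>n. \<Prod>j\<in>J. real_of_int (z (n + j)) ^ e j) \<longlonglongrightarrow> 0" by (simp only:)
  next
    assume R: ?R
    show "chowla_property z" unfolding chowla_property_def conv
    proof (intro allI impI)
      fix r :: nat and s i :: "nat \<Rightarrow> nat"
      assume s: "strict_mono_on {1..r} s" and i: "\<forall>j\<in>{1..r}. i j \<in> {1, 2}" "\<exists>j\<in>{1..r}. i j \<noteq> 2"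
      define t where "t = (\<lambda>j. Suc (s j))"
      have inj: "inj_on t {1..r}"
      proof (rule inj_onI)
        fix p q assume "p \<in> {1..r}" "q \<in> {1..r}" "t p = t q"
        thus "p = q" using strict_mono_onD[OF s, of p q] strict_mono_onD[OF s, of q p]
          by (cases p q rule: linorder_cases) (auto simp: t_def)
      qed
      \<comment> \<open>Exponents are carried from list positions to offsets; injectivity of
        \<open>t\<close> makes this consistent on the image of \<open>{1..r}\<close>.\<close>
      define e where "e m = i (inv_into {1..r} t m)" for m
      have et: "e (t j) = i j" if "j \<in> {1..r}" for j using inj that by (simp add: e_def)
      have "avg (\<lambda>n. \<Prod>j\<in>t ` {1..r}. real_of_int (z (n + j)) ^ e j) \<longlonglongrightarrow> 0"
      proof (rule R[THEN spec, THEN spec, THEN mp, THEN mp, THEN mp, THEN mp])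
        show "t ` {1..r} \<subseteq> {1..}" by (auto simp: t_def)
        show "\<exists>j\<in>t ` {1..r}. e j = 1" proof -
          obtain j where "j \<in> {1..r}" "i j \<noteq> 2" using i(2) by blast
          moreover hence "i j = 1" using i(1) by blast
          ultimately show ?thesis using et by (intro bexI[of _ "t j"]) auto
        qed
        show "\<forall>j\<in>t ` {1..r}. e j \<in> {1, 2}" using i(1) et by simp
      qed simp
      moreover have "(\<Prod>j\<in>t ` {1..r}. real_of_int (z (n + j)) ^ e j)
          = (\<Prod>j=1..r. real_of_int (z (n + Suc (s j))) ^ i j)" for n
        using et by (subst prod.reindex[OF inj]) (auto simp: t_def intro!: prod.cong)
      ultimately show "avg (\<lambda>n. \<Prod>j=1..r. real_of_int (z (n + Suc (s j))) ^ i j) \<longlonglongrightarrow> 0" by (simp only:)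
    qed
  qed
qed

section \<open>Truncated sieves\<close>

text \<open>Each counted \<open>n\<close> is determined by the quotient
  \<open>(n + j) div d\<close>. This quotient is at least 1 because \<open>n + j\<close> is a
  positive multiple of \<open>d\<close>, so the count has no extra term \<open>+ 1\<close>.\<close>

lemma card_dvd_shifted_le:
  assumes "0 < (d :: nat)" "j \<ge> 1"
  shows "real (card {n. n < N \<and> d dvd n + j}) \<le> real (N + j) / real d"
proof -
  have "card {n. n < N \<and> d dvd n + j} \<le> card {1..(N + j) div d}"
  proof (rule card_inj_on_le)
    show "inj_on (\<lambda>n. (n + j) div d) {n. n < N \<and> d dvd n + j}"
    proof (rule inj_onI)
      fix x y assume "x \<in> {n. n < N \<and> d dvd n + j}" "y \<in> {n. n < N \<and> d dvd n + j}" "(x + j) div d = (y + j) div d"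
      thus "x = y" by (metis (no_types, lifting) add_right_cancel dvd_div_mult_self mem_Collect_eq)
    qed
    show "(\<lambda>n. (n + j) div d) ` {n. n < N \<and> d dvd n + j} \<subseteq> {1..(N + j) div d}"
    proof (intro image_subsetI)
      fix n assume n: "n \<in> {n. n < N \<and> d dvd n + j}"
      hence "d \<le> n + j" using assms by (intro dvd_imp_le) auto
      thus "(n + j) div d \<in> {1..(N + j) div d}"
        using n assms by (auto simp: Suc_le_eq div_greater_zero_iff intro: div_le_mono)
    qed
  qed simp
  hence "real (card {n. n < N \<and> d dvd n + j}) \<le> real ((N + j) div d)" by simp
  also have "\<dots> \<le> real (N + j) / real d" by (rule of_nat_div_le_of_nat)
  finally show ?thesis .
qed

locale coprime_sequence =
  fixes a :: "nat \<Rightarrow> nat"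
  assumes a_ge: "\<And>k. k \<ge> 1 \<Longrightarrow> a k \<ge> 2"
    and a_coprime: "pairwise (\<lambda>j k. coprime (a j) (a k)) {1..}"
begin

abbreviation b :: "nat \<Rightarrow> nat" where "b \<equiv> b_seq a"

text \<open>With \<open>I = {1..}\<close> this is a product of shifts of \<open>eta_seq a\<close>
  over the offsets in \<open>A\<close>; with \<open>I = {1..K}\<close> it is the periodic truncation
  of that product.\<close>

definition sieve :: "nat set \<Rightarrow> nat set \<Rightarrow> nat \<Rightarrow> real" where
  "sieve I A n = of_bool (\<forall>k\<in>I. \<forall>j\<in>A. \<not> b k dvd n + j)"

definition tail :: "nat \<Rightarrow> real" where
  "tail K = (\<Sum>i. 1 / real (b (i + Suc K)))"

lemma b_pos: "k \<ge> 1 \<Longrightarrow> b k > 0"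
  using a_ge[of k] by (auto simp: b_seq_def)

lemma b_coprime: "i \<ge> 1 \<Longrightarrow> k \<ge> 1 \<Longrightarrow> i \<noteq> k \<Longrightarrow> coprime (b i) (b k)"
  using a_coprime by (auto simp: b_seq_def pairwise_def)

lemma a_eq_iff: "i \<ge> 1 \<Longrightarrow> k \<ge> 1 \<Longrightarrow> a i = a k \<longleftrightarrow> i = k"
proof
  assume ik: "i \<ge> 1" "k \<ge> 1" "a i = a k"
  show "i = k"
  proof (rule ccontr)
    assume "i \<noteq> k"
    hence "coprime (a i) (a k)" using a_coprime ik(1,2) by (simp add: pairwise_def)
    thus False using ik(3) a_ge[OF ik(2)] by simp
  qed
qed simp

text \<open>Pairwise coprime numbers \<open>\<ge> 2\<close> are distinct, so the series is a
  subseries, up to order, of the convergent sum of \<open>1 / n^2\<close>.\<close>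

lemma summable_inverse_b: "summable (\<lambda>i. 1 / real (b (Suc i)))"
proof -
  have "inj (\<lambda>i. a (Suc i))" by (rule injI) (simp add: a_eq_iff)
  hence "summable ((\<lambda>n. inverse (real n ^ 2)) \<circ> (\<lambda>i. a (Suc i)))"
    using inverse_power_summable[of 2, where 'a = real] by (intro summable_reindex) auto
  thus ?thesis by (simp add: o_def b_seq_def inverse_eq_divide)
qed

lemma summable_tail: "summable (\<lambda>i. 1 / real (b (i + Suc K)))"
  using summable_ignore_initial_segment[OF summable_inverse_b, of K] by simp

lemma tail_tendsto_zero: "tail \<longlonglongrightarrow> 0"
proof -
  have "(\<lambda>K. (\<Sum>i. 1 / real (b (Suc i))) - (\<Sum>i<K. 1 / real (b (Suc i)))) \<longlonglongrightarrow>
      (\<Sum>i. 1 / real (b (Suc i))) - (\<Sum>i. 1 / real (b (Suc i)))"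
    by (intro tendsto_diff tendsto_const summable_LIMSEQ summable_inverse_b)
  thus ?thesis using suminf_minus_initial_segment[OF summable_inverse_b] by (simp add: tail_def[abs_def])
qed

lemma sieve_periodic: "sieve {1..K} A (n + (\<Prod>k=1..K. b k)) = sieve {1..K} A n"
proof -
  have "b k dvd n + (\<Prod>k=1..K. b k) + j \<longleftrightarrow> b k dvd n + j" if "k \<in> {1..K}" for k j
  proof -
    have "b k dvd (\<Prod>k=1..K. b k)" using that by (intro dvd_prodI) auto
    hence "b k dvd (n + j) + (\<Prod>k=1..K. b k) \<longleftrightarrow> b k dvd n + j" by (rule dvd_add_left_iff)
    thus ?thesis by (simp add: ac_simps)
  qed
  thus ?thesis by (simp add: sieve_def)
qed

text \<open>If truncation changes the value at \<open>n\<close>, some \<open>b k\<close> with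
  \<open>k > K\<close> divides a positive number \<open>n + j \<le> N + m\<close>, so
  \<open>b k \<le> N + m\<close>. Only finitely many \<open>k\<close> satisfy this, which turns the
  union bound into a finite sum.\<close>

lemma sieve_diff_le:
  assumes "finite A" "A \<subseteq> {1..m}" "n < N"
  shows "\<bar>sieve {1..K} A n - sieve {1..} A n\<bar>
     \<le> (\<Sum>(j,i)\<in>A \<times> {i. b (i + Suc K) \<le> N + m}. of_bool (b (i + Suc K) dvd n + j))"
    and "finite {i. b (i + Suc K) \<le> N + m}"
proof -
  have "inj (\<lambda>i. b (i + Suc K))" by (rule injI) (auto simp: b_seq_def power2_eq_iff_nonneg a_eq_iff)
  from finite_vimageI[OF finite_atMost[of "N + m"] this]
  show fin: "finite {i. b (i + Suc K) \<le> N + m}" by (simp add: vimage_def)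
  show "\<bar>sieve {1..K} A n - sieve {1..} A n\<bar>
     \<le> (\<Sum>(j,i)\<in>A \<times> {i. b (i + Suc K) \<le> N + m}. of_bool (b (i + Suc K) dvd n + j))"
  proof (cases "sieve {1..K} A n = sieve {1..} A n")
    case False
    then obtain k j where kj: "k \<ge> 1" "j \<in> A" "b k dvd n + j" "\<not> k \<le> K"
      by (auto simp: sieve_def of_bool_def split: if_splits)
    define i where "i = k - Suc K"
    have k: "k = i + Suc K" using kj by (simp add: i_def)
    have "j \<in> {1..m}" using kj assms by auto
    hence "b k \<le> n + j" "n + j \<le> N + m" using dvd_imp_le[OF kj(3)] assms(3) by auto
    hence i: "i \<in> {i. b (i + Suc K) \<le> N + m}" using k by auto
    have "\<bar>sieve {1..K} A n - sieve {1..} A n\<bar> \<le> 1" by (simp add: sieve_def of_bool_def)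
    also have "\<dots> = (case (j, i) of (j, i) \<Rightarrow> of_bool (b (i + Suc K) dvd n + j))" using kj(3) k by simp
    also have "\<dots> \<le> (\<Sum>(j,i)\<in>A \<times> {i. b (i + Suc K) \<le> N + m}. of_bool (b (i + Suc K) dvd n + j))"
      by (rule member_le_sum) (use kj i fin assms(1) in auto)
    finally show ?thesis .
  qed (auto intro!: sum_nonneg)
qed

text \<open>Summing the union bound over \<open>n < N\<close>, each pair of an offset
  \<open>j\<close> and an index \<open>k > K\<close> contributes at most
  \<open>(N + j) / b k\<close>. For \<open>N \<ge> m\<close> this is at most
  \<open>2 * N / b k\<close>, whence the factor 2, and summation over \<open>k\<close> is controlled
  by \<open>tail K\<close>.\<close>

lemma sieve_truncation:
  assumes A: "finite A" "A \<subseteq> {1..}" and h: "\<And>n. \<bar>h n\<bar> \<le> 1"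
  shows "\<forall>\<^sub>F N in sequentially. \<bar>avg (\<lambda>n. sieve {1..K} A n * h n) N - avg (\<lambda>n. sieve {1..} A n * h n) N\<bar>
      \<le> 2 * real (card A) * tail K"
proof -
  obtain m where m: "A \<subseteq> {1..m}"
    using A by (meson atLeastAtMost_iff atLeast_iff finite_nat_set_iff_bounded_le subset_eq)
  \<comment> \<open>The threshold \<open>Suc m\<close> gives both \<open>N + j \<le> 2 * N\<close>
    for all offsets and \<open>N > 0\<close> for the final division.\<close>
  show ?thesis using eventually_ge_at_top[of "Suc m"]
  proof eventually_elim
    case (elim N)
    let ?F = "{i. b (i + Suc K) \<le> N + m}"
    have fin: "finite ?F" using sieve_diff_le(2)[OF A(1) m, of 0] elim by simp
    have "\<bar>(\<Sum>n<N. sieve {1..K} A n * h n) - (\<Sum>n<N. sieve {1..} A n * h n)\<bar>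
       \<le> (\<Sum>n<N. \<bar>sieve {1..K} A n * h n - sieve {1..} A n * h n\<bar>)"
      unfolding sum_subtractf[symmetric] by (rule sum_abs)
    also have "\<dots> \<le> (\<Sum>n<N. \<bar>sieve {1..K} A n - sieve {1..} A n\<bar>)"
      using h by (intro sum_mono) (simp add: abs_mult mult_left_le flip: left_diff_distrib)
    also have "\<dots> \<le> (\<Sum>n<N. \<Sum>(j,i)\<in>A \<times> ?F. of_bool (b (i + Suc K) dvd n + j))"
      by (intro sum_mono sieve_diff_le(1) A m) auto
    also have "\<dots> = (\<Sum>(j,i)\<in>A \<times> ?F. real (card {n. n < N \<and> b (i + Suc K) dvd n + j}))"
    proof (subst sum.swap, rule sum.cong)
      fix p :: "nat \<times> nat"
      obtain j i where p: "p = (j, i)" by force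
      have "(\<Sum>n<N. of_bool (b (i + Suc K) dvd n + j)) = real (card {n. n < N \<and> b (i + Suc K) dvd n + j})"
        by (simp add: sum_of_bool_eq lessThan_def Int_def)
      thus "(\<Sum>n<N. case p of (j,i) \<Rightarrow> of_bool (b (i + Suc K) dvd n + j))
          = (case p of (j,i) \<Rightarrow> real (card {n. n < N \<and> b (i + Suc K) dvd n + j}))" by (simp add: p)
    qed simp
    also have "\<dots> \<le> (\<Sum>(j,i)\<in>A \<times> ?F. 2 * real N * (1 / real (b (i + Suc K))))"
    proof (rule sum_mono)
      fix p assume "p \<in> A \<times> ?F"
      then obtain j i where p: "p = (j, i)" "j \<in> A" by auto
      hence j: "1 \<le> j" "j \<le> m" using m by auto
      have "real (card {n. n < N \<and> b (i + Suc K) dvd n + j}) \<le> real (N + j) / real (b (i + Suc K))"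
        using j by (intro card_dvd_shifted_le b_pos) auto
      also have "\<dots> \<le> 2 * real N / real (b (i + Suc K))"
        using j elim by (intro divide_right_mono) auto
      finally show "(case p of (j,i) \<Rightarrow> real (card {n. n < N \<and> b (i + Suc K) dvd n + j}))
          \<le> (case p of (j,i) \<Rightarrow> 2 * real N * (1 / real (b (i + Suc K))))" by (simp add: p)
    qed
    also have "\<dots> = 2 * real N * real (card A) * (\<Sum>i\<in>?F. 1 / real (b (i + Suc K)))"
      unfolding sum.cartesian_product[symmetric] by (simp add: sum_distrib_left mult_ac)
    also have "\<dots> \<le> 2 * real N * real (card A) * tail K"
      unfolding tail_def by (intro mult_left_mono sum_le_suminf summable_tail fin) auto
    finally show ?case using elim
      by (simp add: avg_def diff_divide_distrib[symmetric] abs_divide divide_le_eq mult_ac)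
  qed
qed

text \<open>Reduces averages against the full sieve to averages against its periodic truncations. It
  serves twice: with \<open>h = 1\<close> for purely quadratic moments, and with \<open>h\<close> a
  product of shifts of \<open>pi_seq a\<close>.\<close>

lemma sieve_mult_tendsto:
  assumes "finite A" "A \<subseteq> {1..}" "\<And>n. \<bar>h n\<bar> \<le> 1"
    and "\<And>K. avg (\<lambda>n. sieve {1..K} A n * h n) \<longlonglongrightarrow> L K" and "L \<longlonglongrightarrow> l"
  shows "avg (\<lambda>n. sieve {1..} A n * h n) \<longlonglongrightarrow> l"
proof (rule tendsto_approx[OF assms(4,5) _ sieve_truncation[OF assms(1-3)]])
  show "(\<lambda>K. 2 * real (card A) * tail K) \<longlonglongrightarrow> 0"
    using tendsto_mult[OF tendsto_const[of "2 * real (card A)"] tail_tendsto_zero] by simp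
qed

end

section \<open>Moments of the limit measures\<close>

lemma measure_PiM_uniform_cylinder:
  assumes A: "\<And>i. i \<in> I \<Longrightarrow> finite (A i) \<and> A i \<noteq> {}"
    and J: "finite J" "J \<subseteq> I" and w: "\<And>j. j \<in> J \<Longrightarrow> w j \<in> A j"
  shows "measure (\<Pi>\<^sub>M i\<in>I. uniform_count_measure (A i)) {\<omega> \<in> (\<Pi>\<^sub>E i\<in>I. A i). \<forall>j\<in>J. \<omega> j = w j}
           = (\<Prod>j\<in>J. 1 / real (card (A j)))"
    and "{\<omega> \<in> (\<Pi>\<^sub>E i\<in>I. A i). \<forall>j\<in>J. \<omega> j = w j} \<in> sets (\<Pi>\<^sub>M i\<in>I. uniform_count_measure (A i))"
proof -
  let ?U = "\<lambda>i. uniform_count_measure (A i)"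
  have pr: "prob_space (?U i)" if "i \<in> I" for i
    using A[OF that] by (intro prob_space_uniform_count_measure) auto
  have eq: "prod_emb I ?U J (\<Pi>\<^sub>E j\<in>J. {w j}) = {\<omega> \<in> (\<Pi>\<^sub>E i\<in>I. A i). \<forall>j\<in>J. \<omega> j = w j}"
    using J by (auto simp: prod_emb_def space_uniform_count_measure PiE_iff extensional_def)
  have s: "{w j} \<in> sets (?U j)" if "j \<in> J" for j
    using w[OF that] by (simp add: sets_uniform_count_measure)
  have "emeasure (PiM I ?U) (prod_emb I ?U J (\<Pi>\<^sub>E j\<in>J. {w j})) = (\<Prod>j\<in>J. emeasure (?U j) {w j})"
    by (intro emeasure_PiM_emb pr J s)
  also have "\<dots> = (\<Prod>j\<in>J. ennreal (1 / real (card (A j))))"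
    using w A J by (intro prod.cong) (auto simp: emeasure_uniform_count_measure subset_eq)
  also have "\<dots> = ennreal (\<Prod>j\<in>J. 1 / real (card (A j)))" by (rule prod_ennreal) simp
  finally show "measure (PiM I ?U) {\<omega> \<in> (\<Pi>\<^sub>E i\<in>I. A i). \<forall>j\<in>J. \<omega> j = w j} = (\<Prod>j\<in>J. 1 / real (card (A j)))"
    unfolding eq measure_def by (simp add: prod_nonneg)
  show "{\<omega> \<in> (\<Pi>\<^sub>E i\<in>I. A i). \<forall>j\<in>J. \<omega> j = w j} \<in> sets (PiM I ?U)"
    unfolding eq[symmetric] by (rule sets_PiM_I) (use J s in auto)
qed

lemma prob_space_bernoulli: "prob_space bernoulli_measure"
  unfolding bernoulli_measure_def by (intro prob_space_PiM prob_space_uniform_count_measure) auto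

lemma sets_bernoulli: "sets bernoulli_measure = sets (seq_algebra {-1, 1})"
  unfolding bernoulli_measure_def seq_algebra_def by (rule sets_PiM_uniform)

text \<open>Independence factors the moment over the coordinates, and the mean of
  \<open>v ^ e\<close> over the two signs is 1 or 0 according to the parity of \<open>e\<close>. The
  weight \<open>1 / 2\<close> is moved into each factor so that the sum over words splits.\<close>

lemma bernoulli_moment:
  assumes "finite J" "J \<subseteq> {1..}"
  shows "(\<integral>y. (\<Prod>j\<in>J. real_of_int (y j) ^ e j) \<partial>bernoulli_measure) = of_bool (\<forall>j\<in>J. even (e j))"
proof -
  have "(\<integral>y. (\<Prod>j\<in>J. real_of_int (y j) ^ e j) \<partial>bernoulli_measure) =
      (\<Sum>w\<in>J \<rightarrow>\<^sub>E {-1, 1}. (\<Prod>j\<in>J. real_of_int (w j) ^ e j) * measure bernoulli_measure (cylinder {-1, 1} J w))"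
    using assms by (intro integral_coordinate_prod prob_space_bernoulli sets_bernoulli) auto
  also have "\<dots> = (\<Sum>w\<in>J \<rightarrow>\<^sub>E {-1, 1}. \<Prod>j\<in>J. real_of_int (w j) ^ e j * (1 / 2))"
  proof (rule sum.cong)
    fix w :: "nat \<Rightarrow> int" assume w: "w \<in> J \<rightarrow>\<^sub>E {-1, 1}"
    have "measure bernoulli_measure (cylinder {-1, 1} J w) = (\<Prod>j\<in>J. 1 / real (card {-1, 1 :: int}))"
      unfolding bernoulli_measure_def cylinder_def seq_space_def
      using PiE_mem[OF w] assms by (intro measure_PiM_uniform_cylinder(1)) auto
    thus "(\<Prod>j\<in>J. real_of_int (w j) ^ e j) * measure bernoulli_measure (cylinder {-1, 1} J w)
        = (\<Prod>j\<in>J. real_of_int (w j) ^ e j * (1 / 2))" by (simp add: prod_dividef power_one_over)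
  qed simp
  also have "\<dots> = (\<Prod>j\<in>J. \<Sum>v\<in>{-1, 1 :: int}. real_of_int v ^ e j * (1 / 2))"
    using assms by (subst prod_sum_PiE) auto
  also have "\<dots> = (\<Prod>j\<in>J. of_bool (even (e j)))"
    by (intro prod.cong) (auto simp: uminus_power_if)
  also have "\<dots> = of_bool (\<forall>j\<in>J. even (e j))"
    using assms(1) by (induction J) auto
  finally show ?thesis .
qed

section \<open>The sieve on the product of the residue groups\<close>

context coprime_sequence
begin

text \<open>Counterpart of \<open>sieve\<close> on residue sequences: at the residues of an integer
  \<open>n\<close> it agrees with \<open>sieve\<close> at \<open>n\<close>, and for
  \<open>I = {1..}\<close> it is the product over \<open>j \<in> A\<close>,
  \<open>j \<ge> 1\<close>, of the coordinates of \<open>phi a \<omega>\<close>.\<close>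

definition Omega_sieve :: "nat set \<Rightarrow> nat set \<Rightarrow> (nat \<Rightarrow> int) \<Rightarrow> real" where
  "Omega_sieve I A \<omega> = of_bool (\<forall>k\<in>I. \<forall>j\<in>A. \<not> [\<omega> k + int j = 0] (mod int (b k)))"

text \<open>Positivity of \<open>b k\<close> matters: for modulus 0 the carrier of
  \<open>integer_mod_group\<close> would be all integers, which is infinite.\<close>

lemma Omega_haar_eq: "Omega_haar a = (\<Pi>\<^sub>M k\<in>{1..}. uniform_count_measure {0..<int (b k)})"
proof -
  have "Omega_haar a = (\<Pi>\<^sub>M k\<in>{1..}. uniform_count_measure (carrier (integer_mod_group (b k))))"
    unfolding Omega_haar_def using b_pos
    by (intro normalized_haar_eq_PiM) (auto simp: carrier_integer_mod_group)
  also have "\<dots> = (\<Pi>\<^sub>M k\<in>{1..}. uniform_count_measure {0..<int (b k)})"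
  proof (rule PiM_cong[OF refl])
    fix k :: nat assume "k \<in> {1..}"
    thus "uniform_count_measure (carrier (integer_mod_group (b k))) = uniform_count_measure {0..<int (b k)}"
      using b_pos[of k] by (simp add: carrier_integer_mod_group)
  qed
  finally show ?thesis .
qed

lemma space_Omega: "space (Omega_haar a) = (\<Pi>\<^sub>E k\<in>{1..}. {0..<int (b k)})"
  by (simp add: Omega_haar_eq space_PiM space_uniform_count_measure)

lemma prob_space_Omega: "prob_space (Omega_haar a)"
  unfolding Omega_haar_eq using b_pos
  by (intro prob_space_PiM prob_space_uniform_count_measure) auto

lemma pred_Omega_coordinate:
  assumes "k \<ge> 1"
  shows "{\<omega> \<in> space (Omega_haar a). P (\<omega> k)} \<in> sets (Omega_haar a)"
proof -
  have "(\<lambda>\<omega>. \<omega> k) \<in> measurable (Omega_haar a) (uniform_count_measure {0..<int (b k)})"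
    unfolding Omega_haar_eq using assms by (intro measurable_component_singleton) auto
  moreover have "{x \<in> {0..<int (b k)}. P x} \<in> sets (uniform_count_measure {0..<int (b k)})"
    by (auto simp: sets_uniform_count_measure)
  ultimately have "(\<lambda>\<omega>. \<omega> k) -` {x \<in> {0..<int (b k)}. P x} \<inter> space (Omega_haar a) \<in> sets (Omega_haar a)"
    by (rule measurable_sets)
  also have "(\<lambda>\<omega>. \<omega> k) -` {x \<in> {0..<int (b k)}. P x} \<inter> space (Omega_haar a)
      = {\<omega> \<in> space (Omega_haar a). P (\<omega> k)}"
  proof -
    have "\<omega> k \<in> {0..<int (b k)}" if "\<omega> \<in> space (Omega_haar a)" for \<omega>
      using that assms by (auto simp: space_Omega)
    thus ?thesis by blast
  qed
  finally show ?thesis .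
qed

lemma pred_Omega_all:
  assumes "I \<subseteq> {1..}"
  shows "{\<omega> \<in> space (Omega_haar a). \<forall>k\<in>I. P k (\<omega> k)} \<in> sets (Omega_haar a)"
proof -
  have "{\<omega> \<in> space (Omega_haar a). k \<in> I \<longrightarrow> P k (\<omega> k)} \<in> sets (Omega_haar a)" for k
    using pred_Omega_coordinate[of k "P k"] assms by (cases "k \<in> I") auto
  hence "{\<omega> \<in> space (Omega_haar a). \<forall>k. k \<in> I \<longrightarrow> P k (\<omega> k)} \<in> sets (Omega_haar a)"
    by (rule sets.sets_Collect_countable_All)
  thus ?thesis by (simp add: Ball_def)
qed

lemma measurable_Omega_sieve:
  assumes "I \<subseteq> {1..}"
  shows "Omega_sieve I A \<in> borel_measurable (Omega_haar a)"
proof -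
  have "(\<lambda>\<omega>. of_bool (\<forall>k\<in>I. \<forall>j\<in>A. \<not> [\<omega> k + int j = 0] (mod int (b k))) :: real) \<in> borel_measurable (Omega_haar a)"
    unfolding of_bool_def
    using pred_Omega_all[OF assms, of "\<lambda>k x. \<forall>j\<in>A. \<not> [x + int j = 0] (mod int (b k))"]
    by (intro measurable_If) auto
  thus ?thesis by (simp add: Omega_sieve_def[abs_def])
qed

text \<open>The truncated sieve depends on the first \<open>K\<close> residues only. By the Chinese
  remainder theorem the cylinders \<open>C n\<close>, \<open>n < B\<close>, given by the residues of
  \<open>n\<close>, partition the space into pieces of mass \<open>1 / B\<close>, so the integral is
  the mean over one period.\<close>

lemma integral_Omega_sieve_finite:
  "(\<integral>\<omega>. Omega_sieve {1..K} A \<omega> \<partial>Omega_haar a)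
     = (\<Sum>n<(\<Prod>k=1..K. b k). sieve {1..K} A n) / real (\<Prod>k=1..K. b k)"
proof -
  interpret prob_space "Omega_haar a" by (rule prob_space_Omega)
  define B where "B = (\<Prod>k=1..K. b k)"
  define res where "res n = (\<lambda>k\<in>{1..K}. int (n mod b k))" for n
  define C where "C n = {\<omega> \<in> (\<Pi>\<^sub>E k\<in>{1..}. {0..<int (b k)}). \<forall>k\<in>{1..K}. \<omega> k = res n k}" for n
  have res_in: "res n \<in> (\<Pi>\<^sub>E k\<in>{1..K}. {0..<int (b k)})" for n
    using b_pos by (auto simp: res_def)
  have inj: "inj_on res {..<B}"
  proof (rule inj_onI)
    fix x y assume xy: "x \<in> {..<B}" "y \<in> {..<B}" "res x = res y"
    have "[x = y] (mod b k)" if "k \<in> {1..K}" for k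
      using fun_cong[OF xy(3), of k] that by (simp add: res_def cong_def del: of_nat_mod)
    hence "[x = y] (mod B)" unfolding B_def
      by (intro coprime_cong_prod_nat) (auto intro: b_coprime)
    thus "x = y" using xy by (simp add: cong_def)
  qed
  \<comment> \<open>Surjectivity by counting: \<open>res\<close> is injective on
    \<open>{..<B}\<close>, and the target also has \<open>B\<close> elements.\<close>
  have "res ` {..<B} = (\<Pi>\<^sub>E k\<in>{1..K}. {0..<int (b k)})"
  proof (rule card_subset_eq)
    show "card (res ` {..<B}) = card (\<Pi>\<^sub>E k\<in>{1..K}. {0..<int (b k)})"
      unfolding card_image[OF inj] by (simp add: card_PiE B_def)
  qed (use res_in in \<open>auto intro!: finite_PiE\<close>)
  hence surj: "\<exists>n<B. v = res n" if "v \<in> (\<Pi>\<^sub>E k\<in>{1..K}. {0..<int (b k)})" for v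
    using that by (metis imageE lessThan_iff)
  have C: "prob (C n) = 1 / real B" "C n \<in> sets (Omega_haar a)" for n
  proof -
    have "prob (C n) = (\<Prod>k=1..K. 1 / real (card {0..<int (b k)}))"
      unfolding C_def Omega_haar_eq
      using b_pos PiE_mem[OF res_in] by (intro measure_PiM_uniform_cylinder(1)) auto
    thus "prob (C n) = 1 / real B" by (simp add: B_def prod_dividef)
    show "C n \<in> sets (Omega_haar a)"
      unfolding C_def Omega_haar_eq
      using b_pos PiE_mem[OF res_in] by (intro measure_PiM_uniform_cylinder(2)) auto
  qed
  have "(\<integral>\<omega>. Omega_sieve {1..K} A \<omega> \<partial>Omega_haar a)
      = (\<integral>\<omega>. (\<Sum>n<B. sieve {1..K} A n * indicator (C n) \<omega>) \<partial>Omega_haar a)"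
  proof (rule Bochner_Integration.integral_cong[OF refl])
    fix \<omega> assume \<omega>: "\<omega> \<in> space (Omega_haar a)"
    hence "restrict \<omega> {1..K} \<in> (\<Pi>\<^sub>E k\<in>{1..K}. {0..<int (b k)})" by (auto simp: space_Omega PiE_iff)
    from surj[OF this] obtain n where n: "n < B" "restrict \<omega> {1..K} = res n" by blast
    have C_iff: "\<omega> \<in> C m \<longleftrightarrow> m = n" if "m < B" for m
    proof -
      have "\<omega> \<in> C m \<longleftrightarrow> restrict \<omega> {1..K} = res m"
        using \<omega> by (auto simp: C_def space_Omega res_def fun_eq_iff)
      thus ?thesis using inj that n by (auto simp: inj_on_eq_iff)
    qed
    have "[\<omega> k + int j = 0] (mod int (b k)) \<longleftrightarrow> b k dvd n + j" if "k \<in> {1..K}" for k j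
    proof -
      have "\<omega> k = int (n mod b k)" using fun_cong[OF n(2), of k] that by (simp add: res_def)
      hence "[\<omega> k + int j = 0] (mod int (b k)) \<longleftrightarrow> int (b k) dvd int (n + j)"
        by (simp add: cong_0_iff zmod_int dvd_eq_mod_eq_0 mod_add_left_eq)
      thus ?thesis by (simp only: int_dvd_int_iff)
    qed
    hence "Omega_sieve {1..K} A \<omega> = sieve {1..K} A n" by (simp add: Omega_sieve_def sieve_def)
    also have "\<dots> = (\<Sum>m<B. if m = n then sieve {1..K} A m else 0)"
      using n by simp
    also have "\<dots> = (\<Sum>m<B. sieve {1..K} A m * indicator (C m) \<omega>)"
      using C_iff by (intro sum.cong) (auto simp: indicator_def)
    finally show "Omega_sieve {1..K} A \<omega> = (\<Sum>m<B. sieve {1..K} A m * indicator (C m) \<omega>)" .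
  qed
  also have "\<dots> = (\<Sum>n<B. sieve {1..K} A n * prob (C n))"
  proof -
    have "C n \<inter> space (Omega_haar a) = C n" for n by (auto simp: C_def space_Omega)
    thus ?thesis using C(2)
      by (subst Bochner_Integration.integral_sum)
        (auto intro!: integrable_real_indicator emeasure_finite simp: less_top[symmetric])
  qed
  also have "\<dots> = (\<Sum>n<B. sieve {1..K} A n) / real B"
    by (simp add: C(1) sum_divide_distrib)
  finally show ?thesis by (simp add: B_def)
qed

text \<open>Pointwise the truncations are eventually constant: one solvable congruence at index
  \<open>k\<close> makes them 0 for all \<open>K \<ge> k\<close>, and otherwise they are all 1.
  Dominated convergence with bound 1 finishes.\<close>

lemma integral_Omega_sieve_tendsto:
  "(\<lambda>K. \<integral>\<omega>. Omega_sieve {1..K} A \<omega> \<partial>Omega_haar a) \<longlonglongrightarrow> (\<integral>\<omega>. Omega_sieve {1..} A \<omega> \<partial>Omega_haar a)"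
proof (rule integral_dominated_convergence[where w = "\<lambda>_. 1"])
  interpret prob_space "Omega_haar a" by (rule prob_space_Omega)
  show "integrable (Omega_haar a) (\<lambda>_. 1 :: real)" by simp
  show "AE \<omega> in Omega_haar a. (\<lambda>K. Omega_sieve {1..K} A \<omega>) \<longlonglongrightarrow> Omega_sieve {1..} A \<omega>"
  proof (rule AE_I2)
    fix \<omega>
    have "\<exists>K0. \<forall>K\<ge>K0. Omega_sieve {1..K} A \<omega> = Omega_sieve {1..} A \<omega>"
    proof (cases "\<exists>k\<ge>1. \<exists>j\<in>A. [\<omega> k + int j = 0] (mod int (b k))")
      case True
      then obtain k where k: "k \<ge> 1" "\<exists>j\<in>A. [\<omega> k + int j = 0] (mod int (b k))" by blast
      hence "Omega_sieve {1..K} A \<omega> = Omega_sieve {1..} A \<omega>" if "K \<ge> k" for K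
        using that unfolding Omega_sieve_def of_bool_eq_iff by (metis atLeastAtMost_iff atLeast_iff)
      thus ?thesis by blast
    qed (auto simp: Omega_sieve_def)
    thus "(\<lambda>K. Omega_sieve {1..K} A \<omega>) \<longlonglongrightarrow> Omega_sieve {1..} A \<omega>"
      by (intro tendsto_eventually) (simp add: eventually_sequentially)
  qed
  show "AE \<omega> in Omega_haar a. norm (Omega_sieve {1..K} A \<omega>) \<le> 1" for K
    by (simp add: Omega_sieve_def)
qed (rule measurable_Omega_sieve; auto)+

text \<open>For fixed \<open>K\<close> the mean over a period is the integral of the truncated
  sieve; sending \<open>K\<close> to infinity on both sides identifies the limit.\<close>

lemma avg_sieve_tendsto:
  assumes "finite A" "A \<subseteq> {1..}"
  shows "avg (sieve {1..} A) \<longlonglongrightarrow> (\<integral>\<omega>. Omega_sieve {1..} A \<omega> \<partial>Omega_haar a)"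
proof -
  have "avg (\<lambda>n. sieve {1..K} A n * 1) \<longlonglongrightarrow> (\<integral>\<omega>. Omega_sieve {1..K} A \<omega> \<partial>Omega_haar a)" for K
    unfolding integral_Omega_sieve_finite mult_1_right
    using b_pos by (intro avg_periodic sieve_periodic) (auto intro!: prod_pos)
  from sieve_mult_tendsto[OF assms _ this integral_Omega_sieve_tendsto] show ?thesis by simp
qed

lemma phi_eq: "n \<ge> 1 \<Longrightarrow> real_of_int (phi a \<omega> n) = Omega_sieve {1..} {n} \<omega>"
  by (auto simp: phi_def Omega_sieve_def)

lemma measurable_phi: "phi a \<in> measurable (Omega_haar a) (seq_algebra {0, 1})"
  unfolding phi_def seq_algebra_def
proof (rule measurable_restrict)
  fix n :: nat
  have "{\<omega> \<in> space (Omega_haar a). \<forall>k\<in>{1..}. \<not> [\<omega> k + int n = 0] (mod int (b k))} \<in> sets (Omega_haar a)"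
    by (rule pred_Omega_all) simp
  hence "(\<lambda>\<omega>. if \<forall>k\<in>{1..}. \<not> [\<omega> k + int n = 0] (mod int (b k)) then 1 else 0 :: int)
      \<in> measurable (Omega_haar a) (count_space {0, 1})"
    by (intro measurable_If) auto
  moreover have "(\<lambda>\<omega>. if \<exists>k\<ge>1. [\<omega> k + int n = 0] (mod int (b k)) then 0 else 1 :: int)
      = (\<lambda>\<omega>. if \<forall>k\<in>{1..}. \<not> [\<omega> k + int n = 0] (mod int (b k)) then 1 else 0)"
    by (auto simp: fun_eq_iff)
  ultimately show "(\<lambda>\<omega>. if \<exists>k\<ge>1. [\<omega> k + int n = 0] (mod int (b k)) then 0 else 1 :: int)
      \<in> measurable (Omega_haar a) (count_space {0, 1})" by simp
qed

section \<open>Moments of \<open>nu_B\<close> and \<open>nu_M\<close>\<close>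

lemma prob_space_nu_B: "prob_space (nu_B a)"
  unfolding nu_B_def by (rule prob_space.prob_space_distr[OF prob_space_Omega measurable_phi])

lemma sets_nu_B: "sets (nu_B a) = sets (seq_algebra {0, 1})"
  by (simp add: nu_B_def)

text \<open>Coordinates of \<open>phi a \<omega>\<close> are 0 or 1, so positive powers leave them
  unchanged and the moment depends on the index set alone.\<close>

lemma nu_B_moment:
  assumes "finite J" "J \<subseteq> {1..}" "\<And>j. j \<in> J \<Longrightarrow> e j > 0"
  shows "(\<integral>x. (\<Prod>j\<in>J. real_of_int (x j) ^ e j) \<partial>nu_B a) = (\<integral>\<omega>. Omega_sieve {1..} J \<omega> \<partial>Omega_haar a)"
proof -
  have "(\<integral>x. (\<Prod>j\<in>J. real_of_int (x j) ^ e j) \<partial>nu_B a)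
      = (\<integral>\<omega>. (\<Prod>j\<in>J. real_of_int (phi a \<omega> j) ^ e j) \<partial>Omega_haar a)"
    unfolding nu_B_def
    by (rule integral_distr[OF measurable_phi measurable_coordinate_prod[OF assms(2)]])
  also have "\<dots> = (\<integral>\<omega>. Omega_sieve {1..} J \<omega> \<partial>Omega_haar a)"
  proof (rule Bochner_Integration.integral_cong[OF refl])
    fix \<omega>
    have "(\<Prod>j\<in>J. real_of_int (phi a \<omega> j) ^ e j) = (\<Prod>j\<in>J. Omega_sieve {1..} {j} \<omega>)"
    proof (rule prod.cong[OF refl])
      fix j assume j: "j \<in> J"
      thus "real_of_int (phi a \<omega> j) ^ e j = Omega_sieve {1..} {j} \<omega>"
        using assms(2) assms(3)[OF j] by (subst phi_eq) (auto simp: Omega_sieve_def of_bool_def)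
    qed
    also have "\<dots> = Omega_sieve {1..} J \<omega>"
      using assms(1) by (induction J) (auto simp: Omega_sieve_def of_bool_def)
    finally show "(\<Prod>j\<in>J. real_of_int (phi a \<omega> j) ^ e j) = Omega_sieve {1..} J \<omega>" .
  qed
  finally show ?thesis .
qed

text \<open>Each coordinate product is cast to the reals, where multiplication is Borel; its level
  sets then give measurability into the finite discrete space \<open>{-1, 0, 1}\<close>.\<close>

lemma measurable_nu_M_map:
  "(\<lambda>(x, y). \<lambda>n\<in>{1..}. x n * y n) \<in> measurable (nu_B a \<Otimes>\<^sub>M bernoulli_measure) (seq_algebra {-1, 0, 1})"
proof -
  let ?M = "nu_B a \<Otimes>\<^sub>M bernoulli_measure"
  have sp: "space ?M = seq_space {0, 1} \<times> seq_space {-1, 1}"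
    using sets_eq_imp_space_eq[OF sets_nu_B] sets_eq_imp_space_eq[OF sets_bernoulli]
    by (simp add: space_pair_measure space_seq_algebra)
  have "(\<lambda>p. \<lambda>n\<in>{1..}. fst p n * snd p n) \<in> measurable ?M (\<Pi>\<^sub>M n\<in>{1..}. count_space {-1, 0, 1})"
  proof (rule measurable_restrict)
    fix n :: nat assume n: "n \<in> {1..}"
    have x: "(\<lambda>x. real_of_int (x n)) \<in> borel_measurable (nu_B a)"
      using measurable_coordinate[of n real_of_int] n by (simp add: sets_nu_B cong: measurable_cong_sets)
    have y: "(\<lambda>y. real_of_int (y n)) \<in> borel_measurable bernoulli_measure"
      using measurable_coordinate[of n real_of_int] n by (simp add: sets_bernoulli cong: measurable_cong_sets)
    have [measurable]: "(\<lambda>p. real_of_int (fst p n) * real_of_int (snd p n)) \<in> borel_measurable ?M"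
      by (intro borel_measurable_times measurable_compose[OF measurable_fst x] measurable_compose[OF measurable_snd y])
    have "(\<lambda>p. fst p n * snd p n) -` {v} \<inter> space ?M \<in> sets ?M" for v
    proof -
      have "{p \<in> space ?M. real_of_int (fst p n) * real_of_int (snd p n) = real_of_int v} \<in> sets ?M" by measurable
      also have "{p \<in> space ?M. real_of_int (fst p n) * real_of_int (snd p n) = real_of_int v}
          = (\<lambda>p. fst p n * snd p n) -` {v} \<inter> space ?M"
        unfolding of_int_mult[symmetric] of_int_eq_iff by auto
      finally show ?thesis .
    qed
    moreover have "fst p n * snd p n \<in> {-1, 0, 1}" if "p \<in> space ?M" for p
      using that n seq_spaceD[of "fst p" "{0, 1}" n] seq_spaceD[of "snd p" "{-1, 1}" n] by (auto simp: sp)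
    ultimately show "(\<lambda>p. fst p n * snd p n) \<in> measurable ?M (count_space {-1, 0, 1})"
      by (subst measurable_count_space_eq2) auto
  qed
  thus ?thesis by (simp add: seq_algebra_def case_prod_beta)
qed

lemma prob_space_nu_M: "prob_space (nu_M a)"
  unfolding nu_M_def
  by (intro prob_space.prob_space_distr prob_space_pair prob_space_nu_B prob_space_bernoulli measurable_nu_M_map)

lemma sets_nu_M: "sets (nu_M a) = sets (seq_algebra {-1, 0, 1})"
  by (simp add: nu_M_def)

text \<open>A monomial in the products \<open>x n * y n\<close> splits into one in \<open>x\<close>
  and one in \<open>y\<close>. By Fubini the parity factor comes from the signs and the integral
  over \<open>Omega_haar a\<close> from \<open>nu_B a\<close>.\<close>

lemma nu_M_moment:
  assumes J: "finite J" "J \<subseteq> {1..}" and e: "\<And>j. j \<in> J \<Longrightarrow> e j > 0"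
  shows "(\<integral>z. (\<Prod>j\<in>J. real_of_int (z j) ^ e j) \<partial>nu_M a) =
     of_bool (\<forall>j\<in>J. even (e j)) * (\<integral>\<omega>. Omega_sieve {1..} J \<omega> \<partial>Omega_haar a)"
proof -
  let ?M = "nu_B a \<Otimes>\<^sub>M bernoulli_measure"
  interpret B: prob_space "nu_B a" by (rule prob_space_nu_B)
  interpret Y: prob_space bernoulli_measure by (rule prob_space_bernoulli)
  interpret P: pair_prob_space "nu_B a" bernoulli_measure ..
  have sp: "space ?M = seq_space {0, 1} \<times> seq_space {-1, 1}"
    using sets_eq_imp_space_eq[OF sets_nu_B] sets_eq_imp_space_eq[OF sets_bernoulli]
    by (simp add: space_pair_measure space_seq_algebra)
  let ?f = "\<lambda>x y. (\<Prod>j\<in>J. real_of_int (x j) ^ e j) * (\<Prod>j\<in>J. real_of_int (y j) ^ e j)"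
  have x: "(\<lambda>x. \<Prod>j\<in>J. real_of_int (x j) ^ e j) \<in> borel_measurable (nu_B a)"
    using measurable_coordinate_prod[OF J(2)] by (simp add: sets_nu_B cong: measurable_cong_sets)
  have y: "(\<lambda>y. \<Prod>j\<in>J. real_of_int (y j) ^ e j) \<in> borel_measurable bernoulli_measure"
    using measurable_coordinate_prod[OF J(2)] by (simp add: sets_bernoulli cong: measurable_cong_sets)
  have meas: "case_prod ?f \<in> borel_measurable ?M"
    unfolding case_prod_beta
    by (intro borel_measurable_times measurable_compose[OF measurable_fst x] measurable_compose[OF measurable_snd y])
  have int: "integrable ?M (case_prod ?f)"
  proof (rule P.integrable_const_bound[where B = 1])
    show "AE p in ?M. norm (case_prod ?f p) \<le> 1"
    proof (rule AE_I2)
      fix p assume p: "p \<in> space ?M"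
      have "\<bar>real_of_int (fst p j) ^ e j\<bar> \<le> 1 \<and> \<bar>real_of_int (snd p j) ^ e j\<bar> \<le> 1" if "j \<in> J" for j
      proof -
        have "j \<ge> 1" using that J by auto
        with p seq_spaceD[of "fst p" "{0, 1}" j] seq_spaceD[of "snd p" "{-1, 1}" j]
        have "fst p j \<in> {0, 1}" "snd p j \<in> {-1, 1}" by (auto simp: sp)
        hence "\<bar>real_of_int (fst p j)\<bar> \<le> 1" "\<bar>real_of_int (snd p j)\<bar> \<le> 1" by auto
        thus ?thesis by (simp add: power_abs power_le_one)
      qed
      hence "\<bar>\<Prod>j\<in>J. real_of_int (fst p j) ^ e j\<bar> \<le> 1" "\<bar>\<Prod>j\<in>J. real_of_int (snd p j) ^ e j\<bar> \<le> 1"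
        unfolding abs_prod by (auto intro!: prod_le_1)
      thus "norm (case_prod ?f p) \<le> 1"
        by (auto simp: case_prod_beta abs_mult intro!: mult_le_one)
    qed
  qed (rule meas)
  have "(\<integral>z. (\<Prod>j\<in>J. real_of_int (z j) ^ e j) \<partial>nu_M a)
      = (\<integral>p. (\<Prod>j\<in>J. real_of_int ((case p of (x, y) \<Rightarrow> \<lambda>n\<in>{1..}. x n * y n) j) ^ e j) \<partial>?M)"
    unfolding nu_M_def
    by (rule integral_distr[OF measurable_nu_M_map measurable_coordinate_prod[OF J(2)]])
  also have "\<dots> = (\<integral>p. case_prod ?f p \<partial>?M)"
  proof (rule Bochner_Integration.integral_cong[OF refl])
    fix p :: "(nat \<Rightarrow> int) \<times> (nat \<Rightarrow> int)"
    have "(\<Prod>j\<in>J. real_of_int ((case p of (x, y) \<Rightarrow> \<lambda>n\<in>{1..}. x n * y n) j) ^ e j)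
        = (\<Prod>j\<in>J. real_of_int (fst p j) ^ e j * real_of_int (snd p j) ^ e j)"
      using J by (intro prod.cong) (auto simp: case_prod_beta power_mult_distrib subset_eq)
    thus "(\<Prod>j\<in>J. real_of_int ((case p of (x, y) \<Rightarrow> \<lambda>n\<in>{1..}. x n * y n) j) ^ e j) = case_prod ?f p"
      by (simp add: prod.distrib case_prod_beta)
  qed
  also have "\<dots> = (\<integral>x. (\<integral>y. ?f x y \<partial>bernoulli_measure) \<partial>nu_B a)"
    using P.integral_fst'[OF int] by simp
  also have "\<dots> = (\<integral>x. (\<Prod>j\<in>J. real_of_int (x j) ^ e j) \<partial>nu_B a)
      * (\<integral>y. (\<Prod>j\<in>J. real_of_int (y j) ^ e j) \<partial>bernoulli_measure)"
    by simp
  finally show ?thesis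
    using bernoulli_moment[OF J] nu_B_moment[OF J e] by simp
qed

section \<open>Correlations of \<open>pi_seq\<close> and \<open>mu_seq\<close>, and the
  implications\<close>

lemma pi_seq_sq: "m \<ge> 1 \<Longrightarrow> pi_seq a m ^ 2 = 1"
  by (simp add: pi_seq_def flip: power_mult)

lemma eta_prod_eq_sieve:
  assumes "finite J" "J \<subseteq> {1..}" "\<And>j. j \<in> J \<Longrightarrow> e j > 0"
  shows "(\<Prod>j\<in>J. real_of_int (eta_seq a (n + j)) ^ e j) = sieve {1..} J n"
proof -
  have "(\<Prod>j\<in>J. real_of_int (eta_seq a (n + j)) ^ e j) = (\<Prod>j\<in>J. sieve {1..} {j} n)"
  proof (rule prod.cong[OF refl])
    fix j assume "j \<in> J"
    with assms(2) assms(3)[of j] show "real_of_int (eta_seq a (n + j)) ^ e j = sieve {1..} {j} n"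
      by (auto simp: eta_seq_def sieve_def)
  qed
  also have "\<dots> = sieve {1..} J n"
    using assms(1) by (induction J) (auto simp: sieve_def of_bool_def)
  finally show ?thesis .
qed

text \<open>The factors from \<open>eta_seq a\<close> are 0 or 1, so both exponents contribute the
  same sieve; the factors from \<open>pi_seq a\<close> are signs, so only exponent 1 leaves a
  trace.\<close>

lemma mu_prod_eq:
  assumes J: "finite J" "J \<subseteq> {1..}" and e: "\<And>j. j \<in> J \<Longrightarrow> e j \<in> {1, 2}"
  shows "(\<Prod>j\<in>J. real_of_int (mu_seq a (n + j)) ^ e j)
    = sieve {1..} J n * (\<Prod>j\<in>{j \<in> J. e j = 1}. real_of_int (pi_seq a (n + j)))"
proof -
  have "(\<Prod>j\<in>J. real_of_int (mu_seq a (n + j)) ^ e j)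
      = (\<Prod>j\<in>J. real_of_int (eta_seq a (n + j)) ^ e j * real_of_int (pi_seq a (n + j)) ^ e j)"
    using J by (intro prod.cong) (auto simp: mu_seq_def power_mult_distrib)
  also have "\<dots> = sieve {1..} J n * (\<Prod>j\<in>J. real_of_int (pi_seq a (n + j)) ^ e j)"
    unfolding prod.distrib using e by (subst eta_prod_eq_sieve[OF J]) force+
  also have "(\<Prod>j\<in>J. real_of_int (pi_seq a (n + j)) ^ e j)
      = (\<Prod>j\<in>{j \<in> J. e j = 1}. real_of_int (pi_seq a (n + j)))"
  proof (rule prod.mono_neutral_cong_right)
    show "\<forall>j\<in>J - {j \<in> J. e j = 1}. real_of_int (pi_seq a (n + j)) ^ e j = 1"
    proof
      fix j assume j: "j \<in> J - {j \<in> J. e j = 1}"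
      hence "e j = 2" "n + j \<ge> 1" using e J(2) by auto
      thus "real_of_int (pi_seq a (n + j)) ^ e j = 1"
        using pi_seq_sq[of "n + j"] by (simp flip: of_int_power)
    qed
  qed (use J in auto)
  finally show ?thesis .
qed

text \<open>The offsets are those of \<open>J\<close> and of its translate by \<open>q\<close>,
  where overlaps get exponent 2. The largest offset \<open>q + Max J\<close> is not in
  \<open>J\<close>, so it has exponent 1 and the Bernoulli moment vanishes.\<close>

lemma generic_pi_correlation:
  assumes gen: "generic {-1, 1} (pi_seq a) bernoulli_measure"
    and J: "finite J" "J \<subseteq> {1..}" "J \<noteq> {}" and q: "q \<ge> 1"
  shows "avg (\<lambda>n. (\<Prod>j\<in>J. real_of_int (pi_seq a (n + j))) * (\<Prod>j\<in>J. real_of_int (pi_seq a (n + q + j))))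
    \<longlonglongrightarrow> 0"
proof -
  let ?J = "(\<lambda>j. q + j) ` J"
  let ?U = "J \<union> ?J"
  define e :: "nat \<Rightarrow> nat" where "e j = of_bool (j \<in> J) + of_bool (j \<in> ?J)" for j
  have U: "finite ?U" "?U \<subseteq> {1..}" using J by auto
  \<comment> \<open>Writing both products over the common index set \<open>?U\<close> with exponents
    0 or 1 lets the exponents add up to the multiplicity \<open>e\<close>.\<close>
  have sub: "(\<Prod>j\<in>V. x j) = (\<Prod>j\<in>?U. x j ^ of_bool (j \<in> V))" if "V \<subseteq> ?U" for V and x :: "nat \<Rightarrow> real"
    using U(1) that by (intro prod.mono_neutral_cong_left) auto
  have eq: "(\<Prod>j\<in>J. real_of_int (pi_seq a (n + j))) * (\<Prod>j\<in>J. real_of_int (pi_seq a (n + q + j)))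
      = (\<Prod>j\<in>?U. real_of_int (pi_seq a (n + j)) ^ e j)" for n
  proof -
    have "(\<Prod>j\<in>J. real_of_int (pi_seq a (n + q + j))) = (\<Prod>j\<in>?J. real_of_int (pi_seq a (n + j)))"
      by (subst prod.reindex) (auto simp: inj_on_def add.assoc)
    thus ?thesis
      using sub[of J "\<lambda>j. real_of_int (pi_seq a (n + j))"] sub[of ?J "\<lambda>j. real_of_int (pi_seq a (n + j))"]
      by (simp add: e_def power_add prod.distrib)
  qed
  have lim: "avg (\<lambda>n. \<Prod>j\<in>?U. real_of_int (pi_seq a (n + j)) ^ e j)
      \<longlonglongrightarrow> (\<integral>y. (\<Prod>j\<in>?U. real_of_int (y j) ^ e j) \<partial>bernoulli_measure)"
    by (rule generic_avg[OF gen _ U, of "\<lambda>j v. real_of_int v ^ e j"]) simp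
  have "odd (e (q + Max J))"
  proof -
    have "q + Max J \<notin> J" using Max_ge[OF J(1), of "q + Max J"] q by auto
    moreover have "q + Max J \<in> ?J" using Max_in[OF J(1,3)] by simp
    ultimately show ?thesis by (simp add: e_def)
  qed
  moreover have "q + Max J \<in> ?U" using Max_in[OF J(1,3)] by simp
  ultimately have "of_bool (\<forall>j\<in>?U. even (e j)) = (0 :: real)" by auto
  thus ?thesis using lim unfolding bernoulli_moment[OF U] eq by (simp only:)
qed

text \<open>\<open>F\<close> collects the sign factors with exponent 1 and satisfies
  \<open>F^2 = 1\<close>. Against each truncated sieve the van der Corput estimate applies, the
  required decorrelation being that of \<open>pi_seq a\<close> at lag \<open>h\<close> times the
  period; the limits are 0 for every \<open>K\<close>, hence also for the full sieve.\<close>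

lemma generic_pi_imp_chowla:
  assumes gen: "generic {-1, 1} (pi_seq a) bernoulli_measure"
  shows "chowla_property (mu_seq a)"
  unfolding chowla_property_iff
proof (intro allI impI)
  fix J :: "nat set" and e :: "nat \<Rightarrow> nat"
  assume J: "finite J" "J \<subseteq> {1..}" and e: "\<forall>j\<in>J. e j \<in> {1, 2}" "\<exists>j\<in>J. e j = 1"
  define J1 where "J1 = {j \<in> J. e j = 1}"
  have J1: "finite J1" "J1 \<subseteq> {1..}" "J1 \<noteq> {}" using J e(2) by (auto simp: J1_def)
  define F where "F n = (\<Prod>j\<in>J1. real_of_int (pi_seq a (n + j)))" for n
  have F2: "(F n)\<^sup>2 = 1" for n
  proof -
    have "real_of_int (pi_seq a (n + j)) ^ 2 = 1" if "j \<in> J1" for j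
      using that J1(2) pi_seq_sq[of "n + j"] by (simp add: subset_eq trans_le_add2 flip: of_int_power)
    thus ?thesis by (simp add: F_def prod_power_distrib)
  qed
  have "avg (\<lambda>n. sieve {1..} J n * F n) \<longlonglongrightarrow> 0"
  proof (rule sieve_mult_tendsto[OF J, where L = "\<lambda>_. 0"])
    show "\<bar>F n\<bar> \<le> 1" for n using F2[of n] by (simp add: abs_square_eq_1)
    show "avg (\<lambda>n. sieve {1..K} J n * F n) \<longlonglongrightarrow> 0" for K
    proof (rule avg_periodic_mult_tendsto_zero[of "sieve {1..K} J" "\<Prod>k=1..K. b k" F, OF sieve_periodic _ F2])
      show "\<bar>sieve {1..K} J n\<bar> \<le> 1" for n by (simp add: sieve_def)
      fix h :: nat assume h: "h \<ge> 1"
      have "(\<Prod>k=1..K. b k) > 0" using b_pos by (auto intro!: prod_pos)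
      \<comment> \<open>A lag of 0 would make the correlation equal to 1, so the period has to be
        positive here.\<close>
      hence "h * (\<Prod>k=1..K. b k) \<ge> 1" using h by (simp add: Suc_le_eq)
      thus "avg (\<lambda>n. F n * F (n + h * (\<Prod>k=1..K. b k))) \<longlonglongrightarrow> 0"
        unfolding F_def by (rule generic_pi_correlation[OF gen J1])
    qed
  qed auto
  thus "avg (\<lambda>n. \<Prod>j\<in>J. real_of_int (mu_seq a (n + j)) ^ e j) \<longlonglongrightarrow> 0"
    using e(1) by (simp add: mu_prod_eq[OF J] F_def J1_def)
qed

lemma generic_nu_M_imp_chowla:
  assumes gen: "generic {-1, 0, 1} (mu_seq a) (nu_M a)"
  shows "chowla_property (mu_seq a)"
  unfolding chowla_property_iff
proof (intro allI impI)
  fix J :: "nat set" and e :: "nat \<Rightarrow> nat"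
  assume J: "finite J" "J \<subseteq> {1..}" and e: "\<forall>j\<in>J. e j \<in> {1, 2}" "\<exists>j\<in>J. e j = 1"
  have "avg (\<lambda>n. \<Prod>j\<in>J. real_of_int (mu_seq a (n + j)) ^ e j)
      \<longlonglongrightarrow> (\<integral>z. (\<Prod>j\<in>J. real_of_int (z j) ^ e j) \<partial>nu_M a)"
    by (rule generic_avg[OF gen _ J, of "\<lambda>j v. real_of_int v ^ e j"]) simp
  also have "(\<integral>z. (\<Prod>j\<in>J. real_of_int (z j) ^ e j) \<partial>nu_M a) = 0"
    using e by (subst nu_M_moment[OF J]) force+
  finally show "avg (\<lambda>n. \<Prod>j\<in>J. real_of_int (mu_seq a (n + j)) ^ e j) \<longlonglongrightarrow> 0" .
qed

lemma mu_seq_in: "mu_seq a \<in> seq_space {-1, 0, 1}"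
  by (auto simp: mu_seq_def seq_space_def eta_seq_def pi_seq_def minus_one_power_iff)

text \<open>Moment by moment: an exponent 1 makes the average tend to 0 by the Chowla property and
  the integral vanish by parity, while all exponents 2 leave the frequency of the sieve.\<close>

lemma chowla_imp_generic_nu_M:
  assumes ch: "chowla_property (mu_seq a)"
  shows "generic {-1, 0, 1} (mu_seq a) (nu_M a)"
proof (rule genericI_moments[OF mu_seq_in prob_space_nu_M sets_nu_M])
  fix J :: "nat set" and e :: "nat \<Rightarrow> nat"
  assume J: "finite J" "J \<subseteq> {1..}" and e: "\<And>j. j \<in> J \<Longrightarrow> e j \<in> {1, 2}"
  have moment: "(\<integral>z. (\<Prod>j\<in>J. real_of_int (z j) ^ e j) \<partial>nu_M a) =
      of_bool (\<forall>j\<in>J. even (e j)) * (\<integral>\<omega>. Omega_sieve {1..} J \<omega> \<partial>Omega_haar a)"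
    by (rule nu_M_moment[OF J]) (use e in force)
  show "avg (\<lambda>n. \<Prod>j\<in>J. real_of_int (mu_seq a (n + j)) ^ e j)
      \<longlonglongrightarrow> (\<integral>z. (\<Prod>j\<in>J. real_of_int (z j) ^ e j) \<partial>nu_M a)"
  proof (cases "\<exists>j\<in>J. e j = 1")
    case True
    hence "avg (\<lambda>n. \<Prod>j\<in>J. real_of_int (mu_seq a (n + j)) ^ e j) \<longlonglongrightarrow> 0"
      using ch J e unfolding chowla_property_iff by blast
    moreover have "of_bool (\<forall>j\<in>J. even (e j)) = (0 :: real)" using True by force
    ultimately show ?thesis unfolding moment by (simp only: mult_zero_left)
  next
    case False
    hence "{j \<in> J. e j = 1} = {}" by auto
    hence "avg (\<lambda>n. \<Prod>j\<in>J. real_of_int (mu_seq a (n + j)) ^ e j) = avg (sieve {1..} J)"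
      by (intro avg_cong) (simp only: mu_prod_eq[OF J e] prod.empty mult_1_right)
    moreover have "of_bool (\<forall>j\<in>J. even (e j)) = (1 :: real)" using False e by force
    ultimately show ?thesis unfolding moment using avg_sieve_tendsto[OF J] by (simp only: mult_1_left)
  qed
qed

end

theorem theorem6p1:
  fixes a :: "nat \<Rightarrow> nat"
  assumes a_ge: "\<And>k. k \<ge> 1 \<Longrightarrow> a k \<ge> 2"
    and a_coprime: "pairwise (\<lambda>j k. coprime (a j) (a k)) {1..}"
  shows "(generic {-1, 1} (pi_seq a) bernoulli_measure \<longrightarrow>
            generic {-1, 0, 1} (mu_seq a) (nu_M a)) \<and>
         (generic {-1, 0, 1} (mu_seq a) (nu_M a) \<longleftrightarrow> chowla_property (mu_seq a))"
proof -
  interpret coprime_sequence a by unfold_locales (fact a_ge a_coprime)+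
  \<comment> \<open>The first implication is obtained through the Chowla property, by composing it
    with the converse direction of the equivalence.\<close>
  show ?thesis
    using generic_pi_imp_chowla generic_nu_M_imp_chowla chowla_imp_generic_nu_M by blast
qed

end
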